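(* Let $\mathcal Z$ be a real separable Hilbert space. For $i=1,2$ let $F_i:\mathcal Z\to\mathcal Z$ be monotone and $L_{F_i}$-Lipschitz continuous and let $g_i\in\Gamma_0(\mathcal Z)$, with $\mathrm{dom}(g_1)\cap\mathrm{dom}(g_2)\neq\emptyset$. Assume moreover that $F_1$ is $\mu$-strongly monotone with $\mu>0$, i.e. $\langle F_1(z_1)-F_1(z_2),z_1-z_2\rangle\ge\mu\|z_1-z_2\|^2$ for all $z_1,z_2\in\mathcal Z$. Let $\mathcal S_2=\mathrm{zer}(F_2+\partial g_2)$ and assume $\mathcal S_2\ne\emptyset$. Let $\mathcal S_1$ be the solution set of the hierarchical problem (see context) and assume $\mathcal S_1=\mathrm{zer}(F_1+\partial g_1+N_{\mathcal S_2})\neq\emptyset$. Assume that $\mathrm{dom}(g_1)\cap\mathrm{dom}(g_2)$ is closed and that for all compact sets $\mathcal A,\mathcal B\subset\mathrm{dom}(g_1)\cap\mathrm{dom}(g_2)$ one has $\sup_{(x,y)\in\mathcal A\times\mathcal B}|g_1(x)-g_1(y)|<\infty$. Let $(t_k)_{k\ge1}\subset(0,\infty)$ and let $(\sigma_k)_{k\ge1}\subset(0,\infty)$ be decreasing ($\sigma_{k+1}\le\sigma_k$), with $$\lim_{k\to\infty}\sigma_k=0,\quad \lim_{K\to\infty}\sum_{k=1}^K t_k=\infty,\quad \lim_{K\to\infty}\sigma_K\sum_{k=1}^K t_k=\infty,\quad \lim_{K\to\infty}\frac{\sum_{k=1}^K t_k\sigma_k}{\sum_{k=1}^K t_k}=0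 .$$ Assume additionally that at least one of the following holds: (1) for every $p\in\mathrm{Range}(N_{\mathcal S_2})$, $\ \sum_{k=1}^\infty t_k\big[\sup_{z\in\mathcal S_2}\varphi^{(F_2,g_2)}(z,\sigma_kp)-\mathtt s(\sigma_kp\,|\,\mathcal S_2)\big]<\infty$; (2) $\mathrm{dom}(g_1)\cap\mathrm{dom}(g_2)$ is compact. Let $z^1=z^{1/2}\in\mathcal Z$ and let $(z^k),(z^{k+1/2})$ be generated by the optimistic extragradient method (see context), where, with $L_k=L_{F_2}+\sigma_kL_{F_1}$, $$8t_k^2L_k^2+2t_k\sigma_k\mu\le1\qquad\text{for all }k\ge1.$$ Put $\gamma_0=1$, $\gamma_k=\prod_{i=1}^k(1-t_i\sigma_i\mu)^{-1}$ for $k\ge1$, and $$\bar z^K=\frac{\sum_{i=1}^Kt_i\sigma_i\gamma_iz^{i+1/2}}{\sum_{i=1}^Kt_i\sigma_i\gamma_i}.$$ Let $\mathcal U_2\subset\mathrm{dom}(g_1)\cap\mathrm{dom}(g_2)$ be nonempty and compact. Then there exists a constant $\tilde C_{\mathcal U_2}>0$ (independent of $K$) such that for all $K\ge1$ $$\Theta_{\rm Feas}(\bar z^K|\mathcal U_2)\le\frac{\sigma_1\sup_{z\in\mathcal U_2}\|z^1-z\|^2}{2\sum_{i=1}^Kt_i\sigma_i\gamma_i}+\tilde C_{\mathcal U_2}\frac{\sum_{i=1}^Kt_i\sigma_i^2\gamma_i}{\sum_{i=1}^Kt_i\sigma_i\gamma_i}.$$ Additionally, for any nonempty compact $\mathcal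 U_1\subset\mathrm{dom}(g_1)\cap\mathrm{dom}(g_2)$ with $\mathcal U_1\cap\mathcal S_1\ne\emptyset$ there exists a constant $B_{\mathcal U_1}>0$ (independent of $K$) such that for all $K\ge1$ $$-B_{\mathcal U_1}\mathrm{dist}(\bar z^K,\mathcal S_2)\le\Theta_{\rm Opt}(\bar z^K|\mathcal U_1\cap\mathcal S_2)\le\frac{\sup_{z\in\mathcal U_1\cap\mathcal S_2}\|z^1-z\|^2}{2\sum_{i=1}^Kt_i\sigma_i\gamma_i}.$$ If additionally $\mathcal S_2$ is $(\alpha,\rho)$-weakly sharp (with $\alpha>0$, $\rho\ge1$) and $\mathcal U_2\cap\mathcal S_2\neq\emptyset$, then for the same set $\mathcal U_1$ and the same constants, for all $K\ge1$ $$-B_{\mathcal U_1}\left[\frac{\sigma_1\sup_{z\in\mathcal U_2}\|z^1-z\|^2}{2(\alpha/\rho)\sum_{i=1}^Kt_i\sigma_i\gamma_i}+\frac{\tilde C_{\mathcal U_2}\sum_{i=1}^Kt_i\sigma_i^2\gamma_i}{(\alpha/\rho)\sum_{i=1}^Kt_i\sigma_i\gamma_i}\right]^{1/\rho}\le\Theta_{\rm Opt}(\bar z^K|\mathcal U_1\cap\mathcal S_2).$$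
   Context: $\Gamma_0(\mathcal Z)$ is the class of proper convex lower semicontinuous functions $\mathcal Z\to(-\infty,+\infty]$; $\mathrm{dom}(g)=\{z: g(z)<\infty\}$; $\mathrm{zer}(A)=\{z:0\in A(z)\}$; $N_{\mathcal C}(z)=\{p:\langle p,z'-z\rangle\le0\ \forall z'\in\mathcal C\}$ for $z\in\mathcal C$ is the normal cone and $\mathrm{Range}(N_{\mathcal C})=\bigcup_{z\in\mathcal C}N_{\mathcal C}(z)$; $\mathtt s(p|\mathcal C)=\sup_{z\in\mathcal C}\langle p,z\rangle$ is the support function; $\mathrm{dist}(\cdot,\mathcal C)$ is the distance to $\mathcal C$; $\mathrm{prox}_G(u)=\mathrm{argmin}_{z}\{G(z)+\tfrac12\|z-u\|^2\}$. Hierarchical problem: find $z^*\in\mathcal S_2$ such that $\langle F_1(z^* ),z-z^*\rangle+g_1(z)-g_1(z^* )\ge0$ for all $z\in\mathcal S_2$, where $\mathcal S_2=\mathrm{zer}(F_2+\partial g_2)$. $\mathcal S_1$ denotes its set of solutions. Bifunction: $H^{(F,g)}(z,y)=\langle F(y),z-y\rangle+g(z)-g(y)$. Function $\varphi$: $\varphi^{(F_2,g_2)}(z,u)=\sup_{y\in\mathrm{dom}(g_2)}\{H^{(F_2,g_2)}(z,y)+\langle y,u\rangle\}$. Gap functions: $\Theta_{\rm Feas}(z|\mathcal U)=\sup_{y\in\mathcal U}H^{(F_2,g_2)}(z,y)$ and $\Theta_{\rm Opt}(z|\mathcal U\cap\mathcal S_2)=\sup_{y\in\mathcal U\cap\mathcal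 S_2}H^{(F_1,g_1)}(z,y)$. Weak sharpness: $\mathcal S_2$ is $(\alpha,\rho)$-weakly sharp, $\alpha>0$, $\rho\ge1$, if $H^{(F_2,g_2)}(z,z^* )\ge\frac\alpha\rho\,\mathrm{dist}(z,\mathcal S_2)^\rho$ for all $z^*\in\mathcal S_2$ and all $z\in\mathrm{dom}(g_2)$. Optimistic extragradient method: with $V_k=F_2+\sigma_kF_1$ and $G_k=g_2+\sigma_kg_1$, starting from $z^1=z^{1/2}$, for $k\ge1$: $$z^{k+1/2}=\mathrm{prox}_{t_kG_k}\big(z^k-t_kV_k(z^{k-1/2})\big),\qquad z^{k+1}=\mathrm{prox}_{t_kG_k}\big(z^k-t_kV_k(z^{k+1/2})\big).$$ *)

theory Defs
  imports "HOL-Analysis.Analysis" "HOL-Library.Set_Algebras"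
begin

text \<open>
  A real separable Hilbert space is a type of sort \<open>{real_inner, polish_space}\<close>: an inner product
  space that is complete and second countable, which for metric spaces means separable.
  Functions with values in \<open>(-\<infinity>, +\<infinity>]\<close> are \<open>ereal\<close>-valued functions avoiding \<open>-\<infinity>\<close>.
\<close>

definition edom :: "('a \<Rightarrow> ereal) \<Rightarrow> 'a set" where
  "edom g = {z. g z < \<infinity>}"

definition Gamma0 :: "('a::real_inner \<Rightarrow> ereal) set" where
  "Gamma0 = {g.
     (\<forall>x. g x \<noteq> -\<infinity>) \<and> (\<exists>x. g x \<noteq> \<infinity>) \<and>
     (\<forall>x y. \<forall>l\<in>{0<..<1::real}. g ((1 - l) *\<^sub>R x + l *\<^sub>R y) \<le> ereal (1 - l) * g x + ereal l * g y) \<and>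
     (\<forall>x. g x \<le> Liminf (at x) g)}"

definition monotone_operator :: "('a::real_inner \<Rightarrow> 'a) \<Rightarrow> bool" where
  "monotone_operator F \<longleftrightarrow> (\<forall>x y. 0 \<le> inner (F x - F y) (x - y))"

definition strongly_monotone :: "real \<Rightarrow> ('a::real_inner \<Rightarrow> 'a) \<Rightarrow> bool" where
  "strongly_monotone \<mu> F \<longleftrightarrow> (\<forall>x y. \<mu> * (norm (x - y))\<^sup>2 \<le> inner (F x - F y) (x - y))"

text \<open>
  Set-valued operators are functions into sets; sums of them are pointwise Minkowski sums.
  For a proper \<open>g\<close> the subdifferential is empty outside the domain of \<open>g\<close>.
\<close>

definition subdiff :: "('a::real_inner \<Rightarrow> ereal) \<Rightarrow> 'a \<Rightarrow> 'a set" where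
  "subdiff g z = {p. \<forall>y. g z + ereal (inner p (y - z)) \<le> g y}"

definition normal_cone :: "'a::real_inner set \<Rightarrow> 'a \<Rightarrow> 'a set" where
  "normal_cone C z = (if z \<in> C then {p. \<forall>y\<in>C. inner p (y - z) \<le> 0} else {})"

definition op_range :: "('a \<Rightarrow> 'b set) \<Rightarrow> 'b set" where
  "op_range A = (\<Union>z. A z)"

definition zer :: "('a::real_inner \<Rightarrow> 'a set) \<Rightarrow> 'a set" where
  "zer A = {z. 0 \<in> A z}"

definition support_fun :: "'a::real_inner set \<Rightarrow> 'a \<Rightarrow> ereal" where
  "support_fun C p = (SUP z\<in>C. ereal (inner p z))"

text \<open>
  The minimiser exists and is unique for \<open>G \<in> Gamma0\<close> on a Hilbert space; for other
  functions \<open>prox\<close> may be an unspecified point.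
\<close>

definition prox :: "('a::real_inner \<Rightarrow> ereal) \<Rightarrow> 'a \<Rightarrow> 'a" where
  "prox G u = (ARG_MIN (\<lambda>z. G z + ereal (1/2 * (norm (z - u))\<^sup>2)) z. True)"

text \<open>The bifunction \<open>H\<close> is only ever used with \<open>y\<close> in the domain of \<open>g\<close>, so that
  \<open>\<infinity> - \<infinity>\<close> does not occur.\<close>

definition bifun :: "('a::real_inner \<Rightarrow> 'a) \<Rightarrow> ('a \<Rightarrow> ereal) \<Rightarrow> 'a \<Rightarrow> 'a \<Rightarrow> ereal" where
  "bifun F g z y = ereal (inner (F y) (z - y)) + g z - g y"

definition phi :: "('a::real_inner \<Rightarrow> 'a) \<Rightarrow> ('a \<Rightarrow> ereal) \<Rightarrow> 'a \<Rightarrow> 'a \<Rightarrow> ereal" where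
  "phi F g z u = (SUP y\<in>edom g. bifun F g z y + ereal (inner y u))"

text \<open>
  Solutions of the variational inequality over \<open>S\<close>. The problem is meaningful only where
  \<open>g z\<^sub>* < \<infinity>\<close>, which is therefore part of the definition.
\<close>

definition hier_solutions ::
    "('a::real_inner \<Rightarrow> 'a) \<Rightarrow> ('a \<Rightarrow> ereal) \<Rightarrow> 'a set \<Rightarrow> 'a set" where
  "hier_solutions F g S = {zs \<in> S \<inter> edom g. \<forall>z\<in>S. 0 \<le> bifun F g z zs}"

text \<open>\<open>gap F2 g2 z U\<close> is the feasibility gap and \<open>gap F1 g1 z (U \<inter> S2)\<close> the optimality gap.\<close>

definition gap :: "('a::real_inner \<Rightarrow> 'a) \<Rightarrow> ('a \<Rightarrow> ereal) \<Rightarrow> 'a \<Rightarrow> 'a set \<Rightarrow> ereal" where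
  "gap F g z U = (SUP y\<in>U. bifun F g z y)"

definition weakly_sharp ::
    "('a::real_inner \<Rightarrow> 'a) \<Rightarrow> ('a \<Rightarrow> ereal) \<Rightarrow> 'a set \<Rightarrow> real \<Rightarrow> real \<Rightarrow> bool" where
  "weakly_sharp F g S \<alpha> \<rho> \<longleftrightarrow>
     (\<forall>zs\<in>S. \<forall>z\<in>edom g. ereal (\<alpha> / \<rho> * infdist z S powr \<rho>) \<le> bifun F g z zs)"

text \<open>
  \<open>z k\<close> is the iterate \<open>z\<^sup>k\<close> (\<open>k \<ge> 1\<close>; \<open>z 0\<close> is irrelevant), and \<open>w k\<close> is the half-step
  iterate with upper index \<open>k + 1/2\<close> (\<open>k \<ge> 0\<close>).
\<close>

definition optimistic_extragradient ::
    "('a::real_inner \<Rightarrow> 'a) \<Rightarrow> ('a \<Rightarrow> ereal) \<Rightarrow> ('a \<Rightarrow> 'a) \<Rightarrow> ('a \<Rightarrow> ereal) \<Rightarrow>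
     (nat \<Rightarrow> real) \<Rightarrow> (nat \<Rightarrow> real) \<Rightarrow> (nat \<Rightarrow> 'a) \<Rightarrow> (nat \<Rightarrow> 'a) \<Rightarrow> bool" where
  "optimistic_extragradient F1 g1 F2 g2 t \<sigma> z w \<longleftrightarrow>
     (let V = (\<lambda>k x. F2 x + \<sigma> k *\<^sub>R F1 x);
          G = (\<lambda>k x. g2 x + ereal (\<sigma> k) * g1 x)
      in w 0 = z 1 \<and>
         (\<forall>k\<ge>1.
            w k = prox (\<lambda>x. ereal (t k) * G k x) (z k - t k *\<^sub>R V k (w (k - 1))) \<and>
            z (k + 1) = prox (\<lambda>x. ereal (t k) * G k x) (z k - t k *\<^sub>R V k (w k))))"

definition gam :: "real \<Rightarrow> (nat \<Rightarrow> real) \<Rightarrow> (nat \<Rightarrow> real) \<Rightarrow> nat \<Rightarrow> real" where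
  "gam \<mu> t \<sigma> k = (\<Prod>i=1..k. inverse (1 - t i * \<sigma> i * \<mu>))"

definition weighted_avg :: "(nat \<Rightarrow> real) \<Rightarrow> (nat \<Rightarrow> 'a::real_vector) \<Rightarrow> nat \<Rightarrow> 'a" where
  "weighted_avg c w K = (1 / (\<Sum>i=1..K. c i)) *\<^sub>R (\<Sum>i=1..K. c i *\<^sub>R w i)"

end

theory Submission
  imports Defs
begin

text \<open>
  The proof is a weighted energy argument.  A proximal point \<open>p\<close> of \<open>u\<close> is characterised by
  \<open>u - p\<close> being a subgradient at \<open>p\<close> (\<open>prox_subdiff\<close>).  Writing this for the half step and for the
  full step, for a fixed comparison point \<open>y\<close>, shows that the squared distance of \<open>z k\<close> to \<open>y\<close>
  plus half the squared distance of \<open>z k\<close> to the previous half step is contracted by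
  \<open>1 - t k * \<sigma> k * \<mu>\<close>, up to a multiple of the value at \<open>w k\<close> of the penalised bifunction
  \<open>H2 + \<sigma> k * H1\<close> (\<open>energy_step\<close>).  The extra half square is what pays for using an old operator
  value in the half step.

  The weights \<open>\<gamma> k\<close> undo the contraction, so that the inequality telescopes
  (\<open>weighted_gap_sum\<close>).  For \<open>y\<close> in \<open>S2\<close> the \<open>H2\<close> part is nonnegative, and convexity of \<open>H1\<close> in its
  first argument gives the upper bound for the optimality gap (\<open>optimality_rate\<close>).  With the
  weights \<open>\<sigma> k * \<gamma> k\<close> the inequality still telescopes because \<open>\<sigma>\<close> decreases; now the \<open>H1\<close> part is
  the error, of total size a constant times the sum of \<open>t i * (\<sigma> i)\<^sup>2 * \<gamma> i\<close>
  (\<open>feasibility_rate\<close>).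

  This constant exists as soon as the half steps \<open>w k\<close> are bounded.  They stay in the common domain,
  which settles the compact case.  Under the summability condition, take for \<open>y\<close> a solution of the
  hierarchical problem and let \<open>p\<close> be its multiplier in the normal cone of \<open>S2\<close>.  Then \<open>H1\<close> at
  \<open>w k\<close> is at least \<open>- inner p (w k - y)\<close>, and what the energy can gain in step \<open>k\<close> is at most
  \<open>2 * t k\<close> times the excess of \<open>phi\<close> over the support function at \<open>\<sigma> k *\<^sub>R p\<close>
  (\<open>penalty_excess_lower\<close>), which is summable.

  The same multiplier gives the lower bound for the optimality gap: off \<open>S2\<close> the functional
  \<open>inner p (z - y)\<close> grows at most like \<open>norm p\<close> times the distance to \<open>S2\<close>
  (\<open>normal_cone_infdist\<close>).  Weak sharpness bounds this distance by the feasibility gap.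
\<close>

section \<open>Proper convex lower semicontinuous functions\<close>

lemma Gamma0_finite:
  assumes "g \<in> Gamma0" and "x \<in> edom g"
  shows "g x = ereal (real_of_ereal (g x))"
  using assms unfolding Gamma0_def edom_def by (cases "g x") auto

lemma Gamma0_edom_nonempty:
  assumes "g \<in> Gamma0"
  obtains x where "x \<in> edom g"
  using assms unfolding Gamma0_def edom_def by auto

lemma Gamma0_convex:
  fixes g :: "'a::real_inner \<Rightarrow> ereal"
  assumes g: "g \<in> Gamma0" and "g x \<le> ereal a" and "g y \<le> ereal b" and l: "0 < l" "l < 1"
  shows "g ((1 - l) *\<^sub>R x + l *\<^sub>R y) \<le> ereal ((1 - l) * a + l * b)"
proof -
  have "g ((1 - l) *\<^sub>R x + l *\<^sub>R y) \<le> ereal (1 - l) * g x + ereal l * g y"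
    using g l unfolding Gamma0_def by auto
  also have "\<dots> \<le> ereal (1 - l) * ereal a + ereal l * ereal b"
    using assms by (intro add_mono ereal_mult_left_mono) auto
  finally show ?thesis by simp
qed

lemma Gamma0_lsc:
  assumes "g \<in> Gamma0" and "c < g x"
  shows "\<forall>\<^sub>F y in nhds x. c < g y"
proof -
  have "\<forall>\<^sub>F y in at x. c < g y"
    using assms unfolding Gamma0_def le_Liminf_iff by auto
  then show ?thesis
    using assms(2) unfolding eventually_at_filter
    by (auto elim!: eventually_mono)
qed

text \<open>It suffices to test convexity on the domain and semicontinuity at real levels, where no
  arithmetic with infinities is left.\<close>

lemma Gamma0I:
  fixes g :: "'a::real_inner \<Rightarrow> ereal"
  assumes nm: "\<And>x. g x \<noteq> -\<infinity>" and x0: "x0 \<in> edom g"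
    and conv: "\<And>x y l a b. g x = ereal a \<Longrightarrow> g y = ereal b \<Longrightarrow> 0 < l \<Longrightarrow> l < 1 \<Longrightarrow>
      g ((1 - l) *\<^sub>R x + l *\<^sub>R y) \<le> ereal ((1 - l) * a + l * b)"
    and lsc: "\<And>x c. ereal c < g x \<Longrightarrow> \<forall>\<^sub>F y in nhds x. ereal c < g y"
  shows "g \<in> Gamma0"
proof -
  have "g ((1 - l) *\<^sub>R x + l *\<^sub>R y) \<le> ereal (1 - l) * g x + ereal l * g y"
    if l: "l \<in> {0<..<1}" for x y l
  proof (cases "g x = \<infinity> \<or> g y = \<infinity>")
    case True
    then show ?thesis
      using l nm[of x] nm[of y] by (cases "g x"; cases "g y") auto
  next
    case False
    then obtain a b where "g x = ereal a" "g y = ereal b"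
      using nm[of x] nm[of y] by (cases "g x"; cases "g y") auto
    then show ?thesis using conv[of x a y b l] l by simp
  qed
  moreover have "g x \<le> Liminf (at x) g" for x
    unfolding le_Liminf_iff
  proof (intro allI impI)
    fix c assume c: "c < g x"
    show "\<forall>\<^sub>F y in at x. c < g y"
    proof (cases c)
      case (real r)
      then show ?thesis
        using lsc[of r x] c by (auto simp: eventually_at_filter elim: eventually_mono)
    next
      case MInf
      then have "c < g y" for y using nm[of y] by (cases "g y") auto
      then show ?thesis by simp
    qed (use c in simp)
  qed
  ultimately show ?thesis
    using nm x0 unfolding Gamma0_def edom_def by auto
qed

lemma Gamma0_scale:
  fixes g :: "'a::real_inner \<Rightarrow> ereal"
  assumes g: "g \<in> Gamma0" and c: "0 < c"
  shows "(\<lambda>x. ereal c * g x) \<in> Gamma0"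
proof -
  obtain x0 where x0: "x0 \<in> edom g" using Gamma0_edom_nonempty[OF g] .
  have nm: "g x \<noteq> -\<infinity>" for x using g unfolding Gamma0_def by auto
  have lv: "ereal r < ereal c * g x \<longleftrightarrow> ereal (r / c) < g x" for r x
    using c by (cases "g x") (auto simp: field_simps)
  show ?thesis
  proof (rule Gamma0I[of _ x0])
    show "ereal c * g x \<noteq> -\<infinity>" for x using nm[of x] c by (cases "g x") auto
    show "x0 \<in> edom (\<lambda>x. ereal c * g x)"
      using x0 nm[of x0] c unfolding edom_def by (cases "g x0") auto
  next
    fix x y :: 'a and l a b :: real
    assume "ereal c * g x = ereal a" "ereal c * g y = ereal b" and l: "0 < l" "l < 1"
    then have "g x = ereal (a / c)" "g y = ereal (b / c)"
      using c by (cases "g x"; cases "g y"; auto simp: field_simps split: if_splits)+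
    then have "g ((1 - l) *\<^sub>R x + l *\<^sub>R y) \<le> ereal ((1 - l) * (a / c) + l * (b / c))"
      using l by (intro Gamma0_convex[OF g]) simp_all
    then have "ereal c * g ((1 - l) *\<^sub>R x + l *\<^sub>R y)
        \<le> ereal c * ereal ((1 - l) * (a / c) + l * (b / c))"
      using c by (intro ereal_mult_left_mono) auto
    then show "ereal c * g ((1 - l) *\<^sub>R x + l *\<^sub>R y) \<le> ereal ((1 - l) * a + l * b)"
      using c by (simp add: distrib_left mult.left_commute[of c])
  next
    fix x r assume "ereal r < ereal c * g x"
    then show "\<forall>\<^sub>F y in nhds x. ereal r < ereal c * g y"
      using Gamma0_lsc[OF g, of "ereal (r / c)"] by (simp add: lv)
  qed
qed

lemma Gamma0_add:
  fixes g h :: "'a::real_inner \<Rightarrow> ereal"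
  assumes g: "g \<in> Gamma0" and h: "h \<in> Gamma0" and ne: "edom g \<inter> edom h \<noteq> {}"
  shows "(\<lambda>x. g x + h x) \<in> Gamma0"
proof -
  have nmg: "g x \<noteq> -\<infinity>" for x using g unfolding Gamma0_def by auto
  have nmh: "h x \<noteq> -\<infinity>" for x using h unfolding Gamma0_def by auto
  obtain x0 where x0: "x0 \<in> edom g" "x0 \<in> edom h" using ne by auto
  show ?thesis
  proof (rule Gamma0I[of _ x0])
    show "g x + h x \<noteq> -\<infinity>" for x using nmg[of x] nmh[of x] by simp
    show "x0 \<in> edom (\<lambda>x. g x + h x)" using x0 unfolding edom_def by auto
  next
    fix x y :: 'a and l a b :: real
    assume "g x + h x = ereal a" "g y + h y = ereal b" and l: "0 < l" "l < 1"
    then obtain p q r s where eq: "g x = ereal p" "h x = ereal q" "a = p + q"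
        "g y = ereal r" "h y = ereal s" "b = r + s"
      by (cases "g x"; cases "h x"; cases "g y"; cases "h y") auto
    have "g ((1 - l) *\<^sub>R x + l *\<^sub>R y) + h ((1 - l) *\<^sub>R x + l *\<^sub>R y)
        \<le> ereal ((1 - l) * p + l * r) + ereal ((1 - l) * q + l * s)"
      using eq l by (intro add_mono Gamma0_convex[OF g] Gamma0_convex[OF h]) auto
    then show "g ((1 - l) *\<^sub>R x + l *\<^sub>R y) + h ((1 - l) *\<^sub>R x + l *\<^sub>R y)
        \<le> ereal ((1 - l) * a + l * b)"
      using eq by (simp add: algebra_simps)
  next
    fix x c assume c: "ereal c < g x + h x"
    \<comment> \<open>Split the level \<open>c\<close> into a level below \<open>g x\<close> and a level below \<open>h x\<close>.\<close>
    have "\<exists>p q. c = p + q \<and> ereal p < g x \<and> ereal q < h x"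
    proof (cases "h x")
      case (real s)
      have "ereal (c - s) < g x"
        using c real by (cases "g x") auto
      then obtain p where p: "ereal (c - s) < ereal p" "ereal p < g x"
        using ereal_dense2 by blast
      then show ?thesis
        using real by (intro exI[of _ p] exI[of _ "c - p"]) auto
    next
      case PInf
      obtain p where "ereal p < g x"
        using nmg[of x] ereal_dense2[of "-\<infinity>" "g x"] by auto
      then show ?thesis
        using PInf by (intro exI[of _ p] exI[of _ "c - p"]) auto
    qed (use nmh in auto)
    then obtain p q where pq: "c = p + q" "ereal p < g x" "ereal q < h x" by blast
    have "\<forall>\<^sub>F y in nhds x. ereal p < g y \<and> ereal q < h y"
      using Gamma0_lsc[OF g pq(2)] Gamma0_lsc[OF h pq(3)] by eventually_elim simp
    then show "\<forall>\<^sub>F y in nhds x. ereal c < g y + h y"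
    proof (rule eventually_mono)
      fix y assume "ereal p < g y \<and> ereal q < h y"
      then show "ereal c < g y + h y"
        unfolding pq(1) by (cases "g y"; cases "h y") auto
    qed
  qed
qed

lemma edom_scale: "0 < c \<Longrightarrow> edom (\<lambda>x. ereal c * g x) = edom g"
  unfolding edom_def
proof (intro Collect_cong)
  show "0 < c \<Longrightarrow> (ereal c * g x < \<infinity>) = (g x < \<infinity>)" for x by (cases "g x") auto
qed

lemma edom_add:
  assumes "g \<in> Gamma0" and "h \<in> Gamma0"
  shows "edom (\<lambda>x. g x + h x) = edom g \<inter> edom h"
  using assms unfolding edom_def Gamma0_def by auto

lemma Gamma0_convex_on:
  fixes g :: "'a::real_inner \<Rightarrow> ereal"
  assumes g: "g \<in> Gamma0"
  shows "convex_on (edom g) (\<lambda>x. real_of_ereal (g x))"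
proof -
  have *: "(1 - l) *\<^sub>R x + l *\<^sub>R y \<in> edom g \<and>
     real_of_ereal (g ((1 - l) *\<^sub>R x + l *\<^sub>R y))
      \<le> (1 - l) * real_of_ereal (g x) + l * real_of_ereal (g y)"
    if "x \<in> edom g" "y \<in> edom g" "0 < l" "l < 1" for x y l
  proof -
    let ?v = "(1 - l) *\<^sub>R x + l *\<^sub>R y"
    have le: "g ?v \<le> ereal ((1 - l) * real_of_ereal (g x) + l * real_of_ereal (g y))"
      using that Gamma0_finite[OF g] by (intro Gamma0_convex[OF g]) simp_all
    then have v: "?v \<in> edom g" unfolding edom_def by auto
    moreover have "ereal (real_of_ereal (g ?v))
        \<le> ereal ((1 - l) * real_of_ereal (g x) + l * real_of_ereal (g y))"
      using le Gamma0_finite[OF g v] by simp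
    ultimately show ?thesis by simp
  qed
  have "convex (edom g)"
    unfolding convex_alt
  proof (intro ballI allI impI)
    fix x y u assume xy: "x \<in> edom g" "y \<in> edom g" and u: "0 \<le> u \<and> u \<le> (1::real)"
    show "(1 - u) *\<^sub>R x + u *\<^sub>R y \<in> edom g"
      using *[OF xy, of u] xy u by (cases "u = 0 \<or> u = 1") auto
  qed
  then show ?thesis using * by (intro convex_onI) auto
qed

text \<open>Near a point \<open>x0\<close> of the domain \<open>g\<close> lies above \<open>g x0 - 1\<close>; along a ray from \<open>x0\<close> convexity
  allows \<open>g\<close> to decrease at most linearly after that.  This replaces the usual affine minorant,
  which would need a separation theorem.\<close>

lemma Gamma0_conic_minorant:
  fixes g :: "'a::real_inner \<Rightarrow> ereal"
  assumes g: "g \<in> Gamma0"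
  obtains a b where "0 \<le> b" and "\<And>x. ereal (a - b * norm x) \<le> g x"
proof -
  obtain x0 where x0: "x0 \<in> edom g" using Gamma0_edom_nonempty[OF g] .
  define m where "m = real_of_ereal (g x0)"
  have m: "g x0 = ereal m" using Gamma0_finite[OF g x0] by (simp add: m_def)
  have "\<forall>\<^sub>F y in nhds x0. ereal (m - 1) < g y"
    by (rule Gamma0_lsc[OF g]) (simp add: m)
  then obtain d where d: "d > 0" "\<And>y. dist y x0 < d \<Longrightarrow> ereal (m - 1) < g y"
    unfolding eventually_nhds_metric by blast
  define b where "b = 2 / d"
  have key: "ereal (m - 1 - b * norm (y - x0)) \<le> g y" for y
  proof (cases "dist y x0 < d \<or> g y = \<infinity>")
    case True
    moreover have "0 \<le> b * norm (y - x0)" using d by (simp add: b_def)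
    ultimately show ?thesis using d(2)[of y] by (cases "g y") auto
  next
    case False
    have "g y \<noteq> -\<infinity>" using g unfolding Gamma0_def by auto
    with False obtain r where r: "g y = ereal r" by (cases "g y") auto
    have far: "d \<le> norm (y - x0)" using False by (simp add: dist_norm)
    \<comment> \<open>With this \<open>l\<close> the convex combination lies at distance \<open>d / 2\<close> from \<open>x0\<close>, inside the ball.\<close>
    define l where "l = d / (2 * norm (y - x0))"
    have "0 < norm (y - x0)" using far d(1) by linarith
    then have l: "0 < l" "l < 1" "l * norm (y - x0) = d / 2"
      using far d(1) unfolding l_def by (auto simp: divide_less_eq)
    have "norm (((1 - l) *\<^sub>R x0 + l *\<^sub>R y) - x0) = norm (l *\<^sub>R (y - x0))"
      by (rule arg_cong[of _ _ norm]) (simp add: algebra_simps)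
    also have "\<dots> = d / 2" using l by simp
    finally have "dist ((1 - l) *\<^sub>R x0 + l *\<^sub>R y) x0 < d"
      unfolding dist_norm using d(1) by linarith
    then have "ereal (m - 1) < g ((1 - l) *\<^sub>R x0 + l *\<^sub>R y)" by (rule d(2))
    also have "\<dots> \<le> ereal ((1 - l) * m + l * r)"
      using m r l by (intro Gamma0_convex[OF g]) auto
    finally have "l * (m - r) < 1" by (simp add: algebra_simps)
    then have "m - r < 1 / l" using l(1) by (simp add: field_simps)
    also have "1 / l = b * norm (y - x0)" using far d(1) by (simp add: l_def b_def)
    finally show ?thesis using r by simp
  qed
  show thesis
  proof (rule that[of b "m - 1 - b * norm x0"])
    show b: "0 \<le> b" using d by (simp add: b_def)
    fix x
    have "b * norm (x - x0) \<le> b * (norm x + norm x0)"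
      using b norm_triangle_ineq4[of x x0] by (intro mult_left_mono)
    then have "ereal (m - 1 - b * norm x0 - b * norm x) \<le> ereal (m - 1 - b * norm (x - x0))"
      by (simp add: algebra_simps)
    also have "\<dots> \<le> g x" by (rule key)
    finally show "ereal (m - 1 - b * norm x0 - b * norm x) \<le> g x" .
  qed
qed

section \<open>The proximal point\<close>

text \<open>A minimising sequence is Cauchy because the quadratic term makes the objective uniformly
  convex: the value at the midpoint of two almost-minimisers would otherwise drop below the
  infimum.  Semicontinuity lets the limit attain the infimum.\<close>

lemma prox_minimises:
  fixes G :: "'a::{real_inner, complete_space} \<Rightarrow> ereal"
  assumes G: "G \<in> Gamma0"
  shows "G (prox G u) + ereal (1/2 * (norm (prox G u - u))\<^sup>2) \<le> G y + ereal (1/2 * (norm (y - u))\<^sup>2)"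
proof -
  define f where "f x = G x + ereal (1/2 * (norm (x - u))\<^sup>2)" for x
  obtain a b where b: "0 \<le> b" and ab: "\<And>x. ereal (a - b * norm x) \<le> G x"
    using Gamma0_conic_minorant[OF G] by metis
  obtain x0 where x0: "x0 \<in> edom G" using Gamma0_edom_nonempty[OF G] .
  have lower: "ereal (a - b * norm u - b\<^sup>2 / 2) \<le> f x" for x
  proof -
    have "norm x \<le> norm u + norm (x - u)"
      by (metis add.commute norm_triangle_sub)
    then have "b * norm x \<le> b * norm u + b * norm (x - u)"
      using b by (metis distrib_left mult_left_mono)
    moreover have "0 \<le> (norm (x - u) - b)\<^sup>2" by simp
    ultimately have "a - b * norm u - b\<^sup>2 / 2 \<le> (a - b * norm x) + 1/2 * (norm (x - u))\<^sup>2"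
      by (simp add: power2_eq_square algebra_simps)
    then have "ereal (a - b * norm u - b\<^sup>2 / 2)
        \<le> ereal (a - b * norm x) + ereal (1/2 * (norm (x - u))\<^sup>2)" by simp
    also have "\<dots> \<le> f x" unfolding f_def by (intro add_mono ab) simp
    finally show ?thesis .
  qed
  have "(INF x. f x) \<le> f x0" by (rule INF_lower) simp
  moreover have "f x0 < \<infinity>" using x0 by (simp add: f_def edom_def)
  moreover have "ereal (a - b * norm u - b\<^sup>2 / 2) \<le> (INF x. f x)" by (intro INF_greatest lower)
  ultimately obtain m where m: "(INF x. f x) = ereal m"
    by (cases "INF x. f x") auto
  have m_le: "ereal m \<le> f x" for x unfolding m[symmetric] by (rule INF_lower) simp
  define \<delta> where "\<delta> n = 1 / real (Suc n)" for n :: nat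
  have "\<exists>x. f x < ereal (m + \<delta> n)" for n
  proof -
    have "(INF x. f x) < ereal (m + \<delta> n)" unfolding m \<delta>_def by simp
    then show ?thesis unfolding INF_less_iff by auto
  qed
  then obtain X where X: "\<And>n. f (X n) < ereal (m + \<delta> n)" by metis
  have GX: "G (X n) \<le> ereal (m + \<delta> n - 1/2 * (norm (X n - u))\<^sup>2)" for n
    using X[of n] unfolding f_def by (cases "G (X n)") auto
  have close: "(norm (X i - X j))\<^sup>2 \<le> 4 * (\<delta> i + \<delta> j)" for i j
  proof -
    define v where "v = (1 - 1/2) *\<^sub>R X i + (1/2) *\<^sub>R X j"
    define A where "A = X i - u"
    define B where "B = X j - u"
    have "G v \<le> ereal ((1 - 1/2) * (m + \<delta> i - 1/2 * (norm A)\<^sup>2)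
                     + 1/2 * (m + \<delta> j - 1/2 * (norm B)\<^sup>2))"
      unfolding v_def A_def B_def by (intro Gamma0_convex[OF G] GX) simp_all
    then have "f v \<le> ereal ((1 - 1/2) * (m + \<delta> i - 1/2 * (norm A)\<^sup>2)
                     + 1/2 * (m + \<delta> j - 1/2 * (norm B)\<^sup>2))
                     + ereal (1/2 * (norm (v - u))\<^sup>2)"
      unfolding f_def by (intro add_mono) simp_all
    with m_le[of v] have "m \<le> (1 - 1/2) * (m + \<delta> i - 1/2 * (norm A)\<^sup>2)
                     + 1/2 * (m + \<delta> j - 1/2 * (norm B)\<^sup>2) + 1/2 * (norm (v - u))\<^sup>2"
      using order_trans by fastforce
    moreover have "(norm (v - u))\<^sup>2
        = ((norm A)\<^sup>2 + (norm B)\<^sup>2) / 2 - (norm (X i - X j))\<^sup>2 / 4"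
    proof -
      have "v - u = (1/2) *\<^sub>R (A + B)"
        unfolding v_def A_def B_def
        by (simp add: algebra_simps flip: scaleR_left_distrib)
      moreover have "X i - X j = A - B" by (simp add: A_def B_def)
      ultimately show ?thesis
        by (simp only: power2_norm_eq_inner) (simp add: inner_commute algebra_simps add_divide_distrib diff_divide_distrib)
    qed
    ultimately show ?thesis by (simp add: field_simps)
  qed
  have "Cauchy X"
  proof (rule metric_CauchyI)
    fix e :: real assume e: "0 < e"
    obtain N where N: "8 / e\<^sup>2 < real N" using reals_Archimedean2 by blast
    have "dist (X i) (X j) < e" if "i \<ge> N" "j \<ge> N" for i j
    proof -
      have Npos: "0 < real N" using N e by (smt (verit) divide_pos_pos zero_less_power)
      have "\<delta> i \<le> 1 / real N" "\<delta> j \<le> 1 / real N"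
        unfolding \<delta>_def using that Npos by (auto intro!: divide_left_mono)
      then have "(norm (X i - X j))\<^sup>2 \<le> 8 / real N" using close[of i j] by simp
      also have "\<dots> < e\<^sup>2" using N e Npos by (simp add: field_simps)
      finally show ?thesis unfolding dist_norm using e by (simp add: power2_less_imp_less)
    qed
    then show "\<exists>M. \<forall>i\<ge>M. \<forall>j\<ge>M. dist (X i) (X j) < e" by blast
  qed
  then obtain x where x: "X \<longlonglongrightarrow> x" using Cauchy_convergent convergentD by blast
  have "G x \<le> ereal (m - 1/2 * (norm (x - u))\<^sup>2)"
  proof (rule ccontr)
    assume "\<not> G x \<le> ereal (m - 1/2 * (norm (x - u))\<^sup>2)"
    then obtain c where c: "ereal (m - 1/2 * (norm (x - u))\<^sup>2) < ereal c" "ereal c < G x"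
      using ereal_dense2 not_le by metis
    have "\<forall>\<^sub>F n in sequentially. ereal c < G (X n)"
      using Gamma0_lsc[OF G c(2)] x by (rule eventually_compose_filterlim)
    then have "\<forall>\<^sub>F n in sequentially. c \<le> m + \<delta> n - 1/2 * (norm (X n - u))\<^sup>2"
    proof (rule eventually_mono)
      fix n assume "ereal c < G (X n)"
      also note GX[of n]
      finally show "c \<le> m + \<delta> n - 1/2 * (norm (X n - u))\<^sup>2" by simp
    qed
    moreover have "(\<lambda>n. m + \<delta> n - 1/2 * (norm (X n - u))\<^sup>2)
        \<longlonglongrightarrow> m + 0 - 1/2 * (norm (x - u))\<^sup>2"
      using LIMSEQ_inverse_real_of_nat
      by (intro tendsto_intros x) (simp add: \<delta>_def inverse_eq_divide)
    ultimately have "c \<le> m + 0 - 1/2 * (norm (x - u))\<^sup>2"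
      by (intro tendsto_lowerbound) auto
    with c(1) show False by simp
  qed
  then have "f x \<le> ereal (m - 1/2 * (norm (x - u))\<^sup>2) + ereal (1/2 * (norm (x - u))\<^sup>2)"
    unfolding f_def by (intro add_mono) simp_all
  then have "f x \<le> ereal m" by simp
  then have "is_arg_min f (\<lambda>_. True) x"
    unfolding is_arg_min_def using m_le by (meson leD order_trans)
  then have "is_arg_min f (\<lambda>_. True) (prox G u)"
    unfolding prox_def arg_min_def f_def by (rule someI)
  then show ?thesis unfolding is_arg_min_def f_def by (meson not_le)
qed

lemma prox_in_edom:
  fixes G :: "'a::{real_inner, complete_space} \<Rightarrow> ereal"
  assumes G: "G \<in> Gamma0"
  shows "prox G u \<in> edom G"
proof -
  obtain x0 where "x0 \<in> edom G" using Gamma0_edom_nonempty[OF G] .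
  then have "G (prox G u) + ereal (1/2 * (norm (prox G u - u))\<^sup>2) < \<infinity>"
    using prox_minimises[OF G, of u x0] by (auto simp: edom_def)
  then show ?thesis unfolding edom_def by (cases "G (prox G u)") auto
qed

lemma norm_add_scaleR_power2:
  fixes x y :: "'a::real_inner"
  shows "(norm (x + l *\<^sub>R y))\<^sup>2 = (norm x)\<^sup>2 + 2 * l * inner x y + l\<^sup>2 * (norm y)\<^sup>2"
  by (simp only: power2_norm_eq_inner) (simp add: inner_add inner_commute power2_eq_square algebra_simps)

text \<open>This is Fermat's rule: compare \<open>p = prox G u\<close> with \<open>p + l (y - p)\<close> and let \<open>l\<close> tend to \<open>0\<close>,
  so that the second-order part of the quadratic disappears.\<close>

lemma prox_subdiff:
  fixes G :: "'a::{real_inner, complete_space} \<Rightarrow> ereal"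
  assumes G: "G \<in> Gamma0"
  shows "u - prox G u \<in> subdiff G (prox G u)"
  unfolding subdiff_def
proof (intro CollectI allI)
  fix y
  define p where "p = prox G u"
  obtain q where q: "G p = ereal q"
    using Gamma0_finite[OF G prox_in_edom[OF G]] unfolding p_def by metis
  show "G (prox G u) + ereal (inner (u - prox G u) (y - prox G u)) \<le> G y"
  proof (cases "y \<in> edom G")
    case False
    then show ?thesis by (simp add: edom_def)
  next
    case True
    then obtain r where r: "G y = ereal r" using Gamma0_finite[OF G] by metis
    define a where "a = r - q - inner (u - p) (y - p)"
    define b where "b = 1/2 * (norm (y - p))\<^sup>2"
    have step: "0 \<le> a + l * b" if l: "0 < l" "l < 1" for l
    proof -
      define v where "v = (1 - l) *\<^sub>R p + l *\<^sub>R y"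
      have "ereal (q + 1/2 * (norm (p - u))\<^sup>2) \<le> G v + ereal (1/2 * (norm (v - u))\<^sup>2)"
        using prox_minimises[OF G, of u v] q unfolding p_def by simp
      also have "\<dots> \<le> ereal ((1 - l) * q + l * r) + ereal (1/2 * (norm (v - u))\<^sup>2)"
        unfolding v_def using l q r by (intro add_mono Gamma0_convex[OF G]) simp_all
      finally have "q + 1/2 * (norm (p - u))\<^sup>2 \<le> (1 - l) * q + l * r + 1/2 * (norm (v - u))\<^sup>2"
        by simp
      moreover have "v - u = (p - u) + l *\<^sub>R (y - p)"
        by (simp add: v_def algebra_simps)
      then have "(norm (v - u))\<^sup>2
          = (norm (p - u))\<^sup>2 + 2 * l * inner (p - u) (y - p) + l\<^sup>2 * (norm (y - p))\<^sup>2"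
        by (simp only: norm_add_scaleR_power2)
      moreover have "inner (p - u) (y - p) = - inner (u - p) (y - p)"
        by (metis inner_minus_left minus_diff_eq)
      ultimately have "0 \<le> l * (a + l * b)"
        by (simp add: a_def b_def algebra_simps power2_eq_square)
      then show ?thesis using l by (simp add: zero_le_mult_iff)
    qed
    have "0 \<le> a"
    proof (rule tendsto_lowerbound[where F = "at_right 0"])
      show "((\<lambda>l. a + l * b) \<longlongrightarrow> a) (at_right 0)" by (auto intro!: tendsto_eq_intros)
      show "\<forall>\<^sub>F l in at_right 0. 0 \<le> a + l * b"
        unfolding eventually_at_right[OF zero_less_one] using step by (intro exI[of _ 1]) auto
    qed simp
    then show ?thesis using q r by (simp add: a_def p_def)
  qed
qed

section \<open>Subgradients and the bifunction on the domain\<close>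

text \<open>The finite value that \<^const>\<open>bifun\<close> takes when both points lie in the domain of \<open>g\<close>.\<close>

definition rbifun :: "('a::real_inner \<Rightarrow> 'a) \<Rightarrow> ('a \<Rightarrow> ereal) \<Rightarrow> 'a \<Rightarrow> 'a \<Rightarrow> real" where
  "rbifun F g x y = inner (F y) (x - y) + real_of_ereal (g x) - real_of_ereal (g y)"

lemma bifun_eq_rbifun:
  assumes "g \<in> Gamma0" and "x \<in> edom g" and "y \<in> edom g"
  shows "bifun F g x y = ereal (rbifun F g x y)"
proof -
  obtain a b where "g x = ereal a" "g y = ereal b"
    using Gamma0_finite[OF assms(1)] assms(2,3) by metis
  then show ?thesis unfolding bifun_def rbifun_def by simp
qed

lemma rbifun_convex:
  fixes g :: "'a::real_inner \<Rightarrow> ereal"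
  assumes "g \<in> Gamma0"
  shows "convex_on (edom g) (\<lambda>x. rbifun F g x y)"
proof -
  have c: "convex_on (edom g) (\<lambda>x. real_of_ereal (g x))" by (rule Gamma0_convex_on[OF assms])
  then have "convex (edom g)" by (rule convex_on_imp_convex)
  then have "convex_on (edom g) (\<lambda>x. inner (F y) (x - y) - real_of_ereal (g y))"
    by (intro convex_onI) (simp_all add: algebra_simps)
  from convex_on_add[OF this c] show ?thesis
    unfolding rbifun_def by (simp add: algebra_simps)
qed

lemma rbifun_antisym_le:
  assumes "monotone_operator F"
  shows "rbifun F g x y \<le> - rbifun F g y x"
proof -
  have "0 \<le> inner (F x - F y) (x - y)" using assms unfolding monotone_operator_def by blast
  then show ?thesis unfolding rbifun_def by (simp add: inner_diff algebra_simps)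
qed

lemma subdiff_edom:
  assumes g: "g \<in> Gamma0" and p: "p \<in> subdiff g x"
  shows "x \<in> edom g"
proof -
  obtain y where "y \<in> edom g" using Gamma0_edom_nonempty[OF g] .
  moreover have "g x + ereal (inner p (y - x)) \<le> g y" using p unfolding subdiff_def by blast
  ultimately show ?thesis unfolding edom_def by (cases "g x") auto
qed

lemma subdiff_ineq:
  assumes g: "g \<in> Gamma0" and p: "p \<in> subdiff g x" and y: "y \<in> edom g"
  shows "inner p (y - x) \<le> real_of_ereal (g y) - real_of_ereal (g x)"
proof -
  have "g x + ereal (inner p (y - x)) \<le> g y" using p unfolding subdiff_def by blast
  moreover obtain a b where "g x = ereal a" "g y = ereal b"
    using Gamma0_finite[OF g] y subdiff_edom[OF g p] by metis
  ultimately show ?thesis by simp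
qed

lemma zer_add_subdiff:
  "x \<in> zer (\<lambda>x. {F x} + subdiff g x) \<longleftrightarrow> - F x \<in> subdiff g x"
proof -
  have "0 = F x + q \<longleftrightarrow> q = - F x" for q
    using add_eq_0_iff[of "F x" q] by auto
  then show ?thesis unfolding zer_def set_plus_def by simp
qed

lemma zer_rbifun_nonneg:
  assumes g: "g \<in> Gamma0" and x: "x \<in> zer (\<lambda>x. {F x} + subdiff g x)" and y: "y \<in> edom g"
  shows "0 \<le> rbifun F g y x"
  using subdiff_ineq[OF g _ y, of "- F x" x] x
  unfolding zer_add_subdiff rbifun_def by simp

text \<open>A solution of the upper-level inclusion comes with a multiplier \<open>p\<close> from the normal cone,
  which measures how much the upper-level bifunction can fail to be nonnegative off \<open>S\<close>.\<close>

lemma zer_normal_cone_multiplier: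
  assumes g: "g \<in> Gamma0" and x: "x \<in> zer (\<lambda>x. {F x} + subdiff g x + normal_cone S x)"
  obtains p where "p \<in> normal_cone S x" and "x \<in> edom g" and "x \<in> S"
    and "\<And>y. y \<in> edom g \<Longrightarrow> - inner p (y - x) \<le> rbifun F g y x"
proof -
  obtain q p where q: "q \<in> subdiff g x" and p: "p \<in> normal_cone S x" and 0: "F x + q + p = 0"
    using x unfolding zer_def set_plus_def by auto
  have "x \<in> S" using p unfolding normal_cone_def by (auto split: if_splits)
  moreover have "- inner p (y - x) \<le> rbifun F g y x" if y: "y \<in> edom g" for y
  proof -
    have "inner (F x + q + p) (y - x) = 0" unfolding 0 by simp
    then show ?thesis
      using subdiff_ineq[OF g q y] unfolding rbifun_def inner_add_left by simp
  qed
  ultimately show thesis using that p subdiff_edom[OF g q] by blast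
qed

text \<open>The conic minorant bounds \<open>g x\<close> from below on the ball, while \<open>g y\<close> is bounded from above
  on \<open>U\<close> by the oscillation condition.\<close>

lemma rbifun_lower_bound:
  fixes F :: "'a::real_inner \<Rightarrow> 'a"
  assumes g: "g \<in> Gamma0" and F: "continuous_on U F"
    and U: "U \<noteq> {}" "compact U" "U \<subseteq> edom g"
    and osc: "(SUP (x, y)\<in>U \<times> U. \<bar>g x - g y\<bar>) < \<infinity>"
  obtains C where "C > 0"
    and "\<And>x y. x \<in> edom g \<Longrightarrow> norm x \<le> R \<Longrightarrow> y \<in> U \<Longrightarrow> - C \<le> rbifun F g x y"
proof -
  obtain y0 where y0: "y0 \<in> U" using U by auto
  obtain a b where b: "0 \<le> b" and ab: "\<And>x. ereal (a - b * norm x) \<le> g x"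
    using Gamma0_conic_minorant[OF g] by metis
  have "bounded (F ` U)" using F U by (simp add: compact_continuous_image compact_imp_bounded)
  then obtain M where M: "\<And>y. y \<in> U \<Longrightarrow> norm (F y) \<le> M" unfolding bounded_iff by auto
  obtain N where N: "\<And>y. y \<in> U \<Longrightarrow> norm y \<le> N"
    using compact_imp_bounded[OF U(2)] unfolding bounded_iff by auto
  define S where "S = (SUP (x, y)\<in>U \<times> U. \<bar>g x - g y\<bar>)"
  have S: "\<bar>g x - g y\<bar> \<le> S" if "x \<in> U" "y \<in> U" for x y
    unfolding S_def using that by (intro SUP_upper2[of "(x, y)"]) auto
  have "0 \<le> S" by (rule order_trans[OF abs_ereal_pos S[OF y0 y0]])
  then obtain s where s: "S = ereal s" using osc unfolding S_def[symmetric] by (cases S) auto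
  have M0: "0 \<le> M" using M[OF y0] norm_ge_zero order_trans by blast
  define C where "C = \<bar>M * (\<bar>R\<bar> + N) + b * \<bar>R\<bar> - a + real_of_ereal (g y0) + s\<bar> + 1"
  show thesis
  proof (rule that[of C])
    show "C > 0" unfolding C_def by simp
    fix x y assume x: "x \<in> edom g" "norm x \<le> R" and y: "y \<in> U"
    obtain u v v0 where uv: "g x = ereal u" "g y = ereal v" "g y0 = ereal v0"
      using Gamma0_finite[OF g x(1)] Gamma0_finite[OF g, of y] Gamma0_finite[OF g, of y0]
        y y0 U(3) by blast
    have "v - v0 \<le> s" using S[OF y y0] uv s by simp
    moreover have "a - b * \<bar>R\<bar> \<le> u"
    proof -
      have "b * norm x \<le> b * \<bar>R\<bar>" using x b by (intro mult_left_mono) auto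
      then show ?thesis using ab[of x] uv by simp
    qed
    moreover have "- (M * (\<bar>R\<bar> + N)) \<le> inner (F y) (x - y)"
    proof -
      have "\<bar>inner (F y) (x - y)\<bar> \<le> norm (F y) * norm (x - y)" by (rule Cauchy_Schwarz_ineq2)
      also have "\<dots> \<le> M * (\<bar>R\<bar> + N)"
        using M[OF y] N[OF y] x M0 norm_triangle_ineq4[of x y] by (intro mult_mono) auto
      finally show ?thesis by linarith
    qed
    ultimately show "- C \<le> rbifun F g x y" unfolding C_def rbifun_def uv by simp
  qed
qed

section \<open>Weighted averages and weighted sums\<close>

lemma weighted_avg_Jensen:
  fixes w :: "nat \<Rightarrow> 'a::real_vector"
  assumes f: "convex_on C f" and K: "1 \<le> K"
    and c: "\<And>i. 1 \<le> i \<Longrightarrow> 0 < c i" and w: "\<And>i. 1 \<le> i \<Longrightarrow> w i \<in> C"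
  shows "weighted_avg c w K \<in> C"
    and "f (weighted_avg c w K) * (\<Sum>i=1..K. c i) \<le> (\<Sum>i=1..K. c i * f (w i))"
proof -
  define T where "T = (\<Sum>i=1..K. c i)"
  have T: "0 < T" unfolding T_def using K c by (intro sum_pos) auto
  have avg: "weighted_avg c w K = (\<Sum>i=1..K. (c i / T) *\<^sub>R w i)"
    unfolding weighted_avg_def T_def[symmetric] scaleR_sum_right by (simp add: divide_inverse mult.commute)
  have one: "(\<Sum>i=1..K. c i / T) = 1"
    using T by (simp add: T_def flip: sum_divide_distrib)
  have pos: "0 \<le> c i / T" if "i \<in> {1..K}" for i
    using c[of i] T that by (simp add: less_imp_le)
  show "weighted_avg c w K \<in> C"
    unfolding avg using one pos w convex_on_imp_convex[OF f] by (intro convex_sum) auto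
  have "f (weighted_avg c w K) \<le> (\<Sum>i=1..K. c i / T * f (w i))"
    unfolding avg using one pos w K by (intro convex_on_sum[OF _ _ f]) auto
  also have "\<dots> = (\<Sum>i=1..K. c i * f (w i)) / T"
    unfolding sum_divide_distrib by simp
  finally show "f (weighted_avg c w K) * (\<Sum>i=1..K. c i) \<le> (\<Sum>i=1..K. c i * f (w i))"
    using T unfolding T_def[symmetric] by (simp add: field_simps)
qed

text \<open>A recursion with contraction factors \<open>q k\<close> telescopes under any weights that grow by no
  more than the factors contract.\<close>

lemma weighted_telescope:
  fixes c q e h :: "nat \<Rightarrow> real"
  assumes rec: "\<And>k. 1 \<le> k \<Longrightarrow> e (k + 1) \<le> q k * e k - h k"
    and e: "\<And>k. 1 \<le> k \<Longrightarrow> 0 \<le> e k" and c: "\<And>k. 1 \<le> k \<Longrightarrow> 0 \<le> c k"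
    and cq: "\<And>k. 1 \<le> k \<Longrightarrow> c k * q k \<le> c (k - 1)"
  shows "(\<Sum>k=1..K. c k * h k) + c K * e (K + 1) \<le> c 0 * e 1"
proof (induction K)
  case 0
  show ?case by simp
next
  case (Suc K)
  have "c (Suc K) * e (Suc K + 1) \<le> c (Suc K) * (q (Suc K) * e (Suc K) - h (Suc K))"
    by (intro mult_left_mono rec c) auto
  also have "\<dots> = (c (Suc K) * q (Suc K)) * e (Suc K) - c (Suc K) * h (Suc K)"
    by (simp add: algebra_simps)
  also have "\<dots> \<le> c K * e (Suc K) - c (Suc K) * h (Suc K)"
    using cq[of "Suc K"] e[of "Suc K"] by (intro diff_right_mono mult_right_mono) auto
  finally show ?case using Suc.IH by simp
qed

section \<open>One step of the method\<close>

text \<open>The inequality results from adding the two proximal inequalities and rewriting the inner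
  products by the three-point identity; \<open>a\<close> and \<open>b\<close> stand for the scaled operator values
  used in the half step and in the full step.\<close>

lemma extragradient_step:
  fixes z w zp y a b :: "'a::real_inner" and Gy Gw Gz :: real
  assumes full: "inner (z - b - zp) (y - zp) \<le> Gy - Gz"
    and half: "inner (z - a - w) (zp - w) \<le> Gz - Gw"
  shows "(norm (zp - y))\<^sup>2 \<le> (norm (z - y))\<^sup>2 - (norm (z - w))\<^sup>2 - (norm (zp - w))\<^sup>2
    + 2 * (inner b (y - w) + Gy - Gw) + 2 * inner (b - a) (w - zp)"
proof -
  have "inner (z - b - zp) (y - zp) + inner (z - a - w) (zp - w) \<le> Gy - Gw"
    using assms by linarith
  then show ?thesis
    by (simp add: power2_norm_eq_inner inner_diff_left inner_diff_right inner_commute)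
qed

text \<open>The Lipschitz error is absorbed by Young's inequality: the part in \<open>zp - w\<close> by the
  negative term of the step, and the part in \<open>w - w'\<close>, split at \<open>z\<close>, by the negative term in
  \<open>z - w\<close> and by the memory term in \<open>z - w'\<close>.  Strong monotonicity at \<open>w\<close> is moved to \<open>z\<close> at
  the cost of another multiple of the term in \<open>z - w\<close>.  The step-size condition is what makes
  these costs affordable.\<close>

lemma optimistic_contraction:
  fixes z w w' zp y a b :: "'a::real_inner" and q s d :: real
  assumes step: "(norm (zp - y))\<^sup>2 \<le> (norm (z - y))\<^sup>2 - (norm (z - w))\<^sup>2 - (norm (zp - w))\<^sup>2
      + 2 * d + 2 * inner (b - a) (w - zp)"
    and lip: "norm (b - a) \<le> q * norm (w - w')"
    and d: "d \<le> - h - s * (norm (w - y))\<^sup>2"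
    and s: "0 \<le> s" and qs: "8 * q\<^sup>2 + 2 * s \<le> 1"
  shows "(norm (zp - y))\<^sup>2 + 1/2 * (norm (zp - w))\<^sup>2
    \<le> (1 - s) * ((norm (z - y))\<^sup>2 + 1/2 * (norm (z - w'))\<^sup>2) - 2 * h"
proof -
  have split2: "(norm (u + v))\<^sup>2 \<le> 2 * (norm u)\<^sup>2 + 2 * (norm v)\<^sup>2" for u v :: 'a
  proof -
    have "0 \<le> (norm (u - v))\<^sup>2" by simp
    then show ?thesis
      by (simp add: power2_norm_eq_inner inner_add inner_diff inner_commute)
  qed
  have "2 * inner (b - a) (w - zp) \<le> 2 * (q * norm (w - w') * norm (zp - w))"
  proof -
    have "inner (b - a) (w - zp) \<le> norm (b - a) * norm (w - zp)" by (rule norm_cauchy_schwarz)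
    also have "\<dots> \<le> q * norm (w - w') * norm (zp - w)"
      using lip by (simp add: mult_right_mono norm_minus_commute)
    finally show ?thesis by simp
  qed
  also have "\<dots> \<le> 2 * q\<^sup>2 * (norm (w - w'))\<^sup>2 + 1/2 * (norm (zp - w))\<^sup>2"
  proof -
    have "0 \<le> (2 * (q * norm (w - w')) - norm (zp - w))\<^sup>2" by simp
    then show ?thesis by (simp add: power2_diff power_mult_distrib)
  qed
  also have "2 * q\<^sup>2 * (norm (w - w'))\<^sup>2
      \<le> 2 * q\<^sup>2 * (2 * (norm (z - w))\<^sup>2 + 2 * (norm (z - w'))\<^sup>2)"
    using split2[of "w - z" "z - w'"] by (intro mult_left_mono) (auto simp: norm_minus_commute)
  finally have err: "2 * inner (b - a) (w - zp)
      \<le> 4 * (q\<^sup>2 * (norm (z - w))\<^sup>2) + 4 * (q\<^sup>2 * (norm (z - w'))\<^sup>2) + 1/2 * (norm (zp - w))\<^sup>2"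
    by (simp add: algebra_simps)
  have "s * (norm (z - y))\<^sup>2 \<le> s * (2 * (norm (z - w))\<^sup>2 + 2 * (norm (w - y))\<^sup>2)"
    using split2[of "z - w" "w - y"] s by (intro mult_left_mono) auto
  then have strong: "s * (norm (z - y))\<^sup>2 \<le> 2 * (s * (norm (z - w))\<^sup>2) + 2 * (s * (norm (w - y))\<^sup>2)"
    by (simp add: distrib_left mult.left_commute)
  have "(4 * q\<^sup>2 + 2 * s) * (norm (z - w))\<^sup>2 \<le> 1 * (norm (z - w))\<^sup>2"
    using qs by (intro mult_right_mono) (auto intro: order_trans[rotated])
  then have zw: "4 * (q\<^sup>2 * (norm (z - w))\<^sup>2) + 2 * (s * (norm (z - w))\<^sup>2) \<le> (norm (z - w))\<^sup>2"
    by (simp add: distrib_right mult.assoc)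
  have "(8 * q\<^sup>2 + s) * (norm (z - w'))\<^sup>2 \<le> 1 * (norm (z - w'))\<^sup>2"
    using qs s by (intro mult_right_mono) auto
  then have zw': "8 * (q\<^sup>2 * (norm (z - w'))\<^sup>2) + s * (norm (z - w'))\<^sup>2 \<le> (norm (z - w'))\<^sup>2"
    by (simp add: distrib_right mult.assoc)
  have "(1 - s) * ((norm (z - y))\<^sup>2 + 1/2 * (norm (z - w'))\<^sup>2)
      = (norm (z - y))\<^sup>2 - s * (norm (z - y))\<^sup>2
        + 1/2 * (norm (z - w'))\<^sup>2 - 1/2 * (s * (norm (z - w'))\<^sup>2)"
    by (simp add: left_diff_distrib distrib_left)
  then show ?thesis using step err strong zw zw' d by linarith
qed

section \<open>Normal cones and the penalty excess\<close>

lemma support_fun_at_normal: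
  assumes p: "p \<in> normal_cone S x" and s: "0 \<le> s"
  shows "support_fun S (s *\<^sub>R p) = ereal (s * inner p x)"
proof (rule antisym)
  have x: "x \<in> S" and le: "\<And>y. y \<in> S \<Longrightarrow> inner p (y - x) \<le> 0"
    using p unfolding normal_cone_def by (auto split: if_splits)
  show "support_fun S (s *\<^sub>R p) \<le> ereal (s * inner p x)"
    unfolding support_fun_def using le s
    by (intro SUP_least) (auto simp: inner_diff_right intro: mult_left_mono)
  show "ereal (s * inner p x) \<le> support_fun S (s *\<^sub>R p)"
    unfolding support_fun_def using x by (intro SUP_upper2[of x]) auto
qed

text \<open>The right-hand side is the term that the summability condition controls.  Testing the
  supremum that defines \<^const>\<open>phi\<close> with a point \<open>y\<close> of the domain turns that condition into a
  bound on how far \<open>y\<close> can profit from violating the lower-level problem.\<close>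

lemma penalty_excess_lower:
  assumes g: "g \<in> Gamma0" and p: "p \<in> normal_cone S x" and s: "0 \<le> s"
    and x: "x \<in> edom g" and y: "y \<in> edom g"
  shows "ereal (rbifun F g x y + s * inner p (y - x))
    \<le> (SUP x\<in>S. phi F g x (s *\<^sub>R p)) - support_fun S (s *\<^sub>R p)"
proof -
  have xS: "x \<in> S" using p unfolding normal_cone_def by (auto split: if_splits)
  have "ereal (rbifun F g x y + s * inner p y) = bifun F g x y + ereal (inner y (s *\<^sub>R p))"
    unfolding bifun_eq_rbifun[OF g x y] by (simp add: inner_commute)
  also have "\<dots> \<le> phi F g x (s *\<^sub>R p)" unfolding phi_def using y by (rule SUP_upper)
  also have "\<dots> \<le> (SUP x\<in>S. phi F g x (s *\<^sub>R p))" using xS by (rule SUP_upper)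
  finally have "ereal (rbifun F g x y + s * inner p y) - ereal (s * inner p x)
      \<le> (SUP x\<in>S. phi F g x (s *\<^sub>R p)) - ereal (s * inner p x)"
    by (rule ereal_minus_mono) simp
  then show ?thesis
    unfolding support_fun_at_normal[OF p s] by (simp add: inner_diff_right algebra_simps)
qed

text \<open>Going from \<open>x\<close> to \<open>v\<close> through a point of \<open>S\<close>, only the part outside \<open>S\<close> can be positive.
  Taking the infimum over that point gives the distance to \<open>S\<close> without projecting onto \<open>S\<close>.\<close>

lemma normal_cone_infdist:
  assumes p: "p \<in> normal_cone S x"
  shows "inner p (v - x) \<le> norm p * infdist v S"
proof -
  have x: "x \<in> S" and le: "\<And>y. y \<in> S \<Longrightarrow> inner p (y - x) \<le> 0"
    using p unfolding normal_cone_def by (auto split: if_splits)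
  have near: "inner p (v - x) \<le> norm p * dist v y" if y: "y \<in> S" for y
  proof -
    have "inner p (v - x) = inner p (v - y) + inner p (y - x)" by (simp add: inner_diff_right)
    also have "\<dots> \<le> norm p * norm (v - y) + 0"
      by (intro add_mono norm_cauchy_schwarz le y)
    finally show ?thesis by (simp add: dist_norm)
  qed
  show ?thesis
  proof (cases "p = 0")
    case False
    have "inner p (v - x) / norm p \<le> (INF y\<in>S. dist v y)"
    proof (rule cINF_greatest)
      show "S \<noteq> {}" using x by blast
      show "inner p (v - x) / norm p \<le> dist v y" if "y \<in> S" for y
        using near[OF that] False by (simp add: divide_le_eq mult.commute)
    qed
    then have "inner p (v - x) / norm p \<le> infdist v S"
      using x by (auto simp: infdist_def)
    then show ?thesis using False by (simp add: field_simps)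
  qed simp
qed

section \<open>Runs of the optimistic extragradient method\<close>

locale optimistic_run =
  fixes F1 F2 :: "'a::{real_inner, complete_space} \<Rightarrow> 'a"
    and g1 g2 :: "'a \<Rightarrow> ereal" and L1 L2 \<mu> :: real
    and t \<sigma> :: "nat \<Rightarrow> real" and z w :: "nat \<Rightarrow> 'a"
  assumes F1_lip: "L1-lipschitz_on UNIV F1" and F2_lip: "L2-lipschitz_on UNIV F2"
    and g1: "g1 \<in> Gamma0" and g2: "g2 \<in> Gamma0"
    and dom_nonempty: "edom g1 \<inter> edom g2 \<noteq> {}"
    and \<mu>_pos: "\<mu> > 0" and F1_strong: "strongly_monotone \<mu> F1"
    and t_pos: "\<And>k. 1 \<le> k \<Longrightarrow> 0 < t k" and \<sigma>_pos: "\<And>k. 1 \<le> k \<Longrightarrow> 0 < \<sigma> k"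
    and run: "optimistic_extragradient F1 g1 F2 g2 t \<sigma> z w"
    and stepsize: "\<And>k. 1 \<le> k \<Longrightarrow>
      8 * (t k)\<^sup>2 * (L2 + \<sigma> k * L1)\<^sup>2 + 2 * t k * \<sigma> k * \<mu> \<le> 1"
begin

definition penalised :: "nat \<Rightarrow> 'a \<Rightarrow> ereal" where
  "penalised k x = ereal (t k) * (g2 x + ereal (\<sigma> k) * g1 x)"

lemma penalised_Gamma0:
  assumes "1 \<le> k"
  shows "penalised k \<in> Gamma0" and "edom (penalised k) = edom g1 \<inter> edom g2"
proof -
  have s: "(\<lambda>x. ereal (\<sigma> k) * g1 x) \<in> Gamma0" "edom (\<lambda>x. ereal (\<sigma> k) * g1 x) = edom g1"
    by (rule Gamma0_scale[OF g1 \<sigma>_pos[OF assms]], rule edom_scale[OF \<sigma>_pos[OF assms]])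
  have G: "(\<lambda>x. g2 x + ereal (\<sigma> k) * g1 x) \<in> Gamma0"
    by (rule Gamma0_add[OF g2 s(1)]) (use s(2) dom_nonempty in auto)
  have eq: "penalised k = (\<lambda>x. ereal (t k) * (g2 x + ereal (\<sigma> k) * g1 x))"
    by (rule ext) (rule penalised_def)
  show "penalised k \<in> Gamma0" unfolding eq by (rule Gamma0_scale[OF G t_pos[OF assms]])
  show "edom (penalised k) = edom g1 \<inter> edom g2"
    unfolding eq edom_scale[OF t_pos[OF assms]] edom_add[OF g2 s(1)] s(2) by (rule Int_commute)
qed

lemma real_penalised:
  assumes "x \<in> edom g1 \<inter> edom g2"
  shows "real_of_ereal (penalised k x)
    = t k * (real_of_ereal (g2 x) + \<sigma> k * real_of_ereal (g1 x))"
proof -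
  have "x \<in> edom g1" "x \<in> edom g2" using assms by auto
  from Gamma0_finite[OF g1 this(1)] Gamma0_finite[OF g2 this(2)]
  obtain a b where "g1 x = ereal a" "g2 x = ereal b" by blast
  then show ?thesis unfolding penalised_def by simp
qed

abbreviation V :: "nat \<Rightarrow> 'a \<Rightarrow> 'a" where
  "V k x \<equiv> F2 x + \<sigma> k *\<^sub>R F1 x"

lemma run_eqs:
  shows "w 0 = z 1"
    and "1 \<le> k \<Longrightarrow> w k = prox (penalised k) (z k - t k *\<^sub>R V k (w (k - 1)))"
    and "1 \<le> k \<Longrightarrow> z (k + 1) = prox (penalised k) (z k - t k *\<^sub>R V k (w k))"
  using run unfolding optimistic_extragradient_def Let_def penalised_def[abs_def] by simp_all

lemma iterates_in_domain:
  assumes "1 \<le> k"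
  shows "w k \<in> edom g1 \<inter> edom g2" and "z (k + 1) \<in> edom g1 \<inter> edom g2"
proof -
  note prox_dom = prox_in_edom[OF penalised_Gamma0(1)[OF assms], unfolded penalised_Gamma0(2)[OF assms]]
  show "w k \<in> edom g1 \<inter> edom g2" by (subst run_eqs(2)[OF assms]) (rule prox_dom)
  show "z (k + 1) \<in> edom g1 \<inter> edom g2" by (subst run_eqs(3)[OF assms]) (rule prox_dom)
qed

text \<open>The second term remembers the last half step; it starts at zero.\<close>

definition energy :: "'a \<Rightarrow> nat \<Rightarrow> real" where
  "energy y k = (norm (z k - y))\<^sup>2 + 1/2 * (norm (z k - w (k - 1)))\<^sup>2"

lemma energy_nonneg: "0 \<le> energy y k"
  unfolding energy_def by simp

lemma energy_initial: "energy y 1 = (norm (z 1 - y))\<^sup>2"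
  unfolding energy_def by (simp add: run_eqs(1))

lemma energy_step:
  assumes k: "1 \<le> k" and y: "y \<in> edom g1 \<inter> edom g2"
  shows "energy y (k + 1) \<le> (1 - t k * \<sigma> k * \<mu>) * energy y k
    - 2 * t k * (\<sigma> k * rbifun F1 g1 (w k) y - rbifun F2 g2 y (w k))"
proof -
  define G where "G x = t k * (real_of_ereal (g2 x) + \<sigma> k * real_of_ereal (g1 x))" for x
  define a where "a = t k *\<^sub>R V k (w (k - 1))"
  define b where "b = t k *\<^sub>R V k (w k)"
  define q where "q = t k * (L2 + \<sigma> k * L1)"
  define s where "s = t k * \<sigma> k * \<mu>"
  define d where "d = inner b (y - w k) + G y - G (w k)"
  define h where "h = t k * (\<sigma> k * rbifun F1 g1 (w k) y - rbifun F2 g2 y (w k))"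
  note tk = t_pos[OF k] and sk = \<sigma>_pos[OF k]
  note dom = iterates_in_domain[OF k]
  note pG = penalised_Gamma0[OF k]
  have prox_ineq: "inner (u - x) (v - x) \<le> G v - G x"
    if "x = prox (penalised k) u" "x \<in> edom g1 \<inter> edom g2" "v \<in> edom g1 \<inter> edom g2" for u v x
    using subdiff_ineq[OF pG(1) prox_subdiff[OF pG(1)], of v u] that
    unfolding G_def pG(2) by (simp add: real_penalised)
  have "inner (z k - b - z (k + 1)) (y - z (k + 1)) \<le> G y - G (z (k + 1))"
    using prox_ineq[OF run_eqs(3)[OF k] dom(2) y] unfolding b_def .
  moreover have "inner (z k - a - w k) (z (k + 1) - w k) \<le> G (z (k + 1)) - G (w k)"
    using prox_ineq[OF run_eqs(2)[OF k] dom(1) dom(2)] unfolding a_def .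
  ultimately have "(norm (z (k + 1) - y))\<^sup>2
      \<le> (norm (z k - y))\<^sup>2 - (norm (z k - w k))\<^sup>2 - (norm (z (k + 1) - w k))\<^sup>2
        + 2 * d + 2 * inner (b - a) (w k - z (k + 1))"
    unfolding d_def by (rule extragradient_step)
  moreover have "norm (b - a) \<le> q * norm (w k - w (k - 1))"
  proof -
    have "b - a = t k *\<^sub>R ((F2 (w k) - F2 (w (k - 1))) + \<sigma> k *\<^sub>R (F1 (w k) - F1 (w (k - 1))))"
      unfolding a_def b_def by (simp add: algebra_simps)
    then have "norm (b - a)
        = t k * norm ((F2 (w k) - F2 (w (k - 1))) + \<sigma> k *\<^sub>R (F1 (w k) - F1 (w (k - 1))))"
      using tk by simp
    also have "\<dots> \<le> t k * (norm (F2 (w k) - F2 (w (k - 1)))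
        + norm (\<sigma> k *\<^sub>R (F1 (w k) - F1 (w (k - 1)))))"
      using tk by (intro mult_left_mono norm_triangle_ineq) simp
    also have "\<dots> = t k * (norm (F2 (w k) - F2 (w (k - 1)))
        + \<sigma> k * norm (F1 (w k) - F1 (w (k - 1))))"
      using sk by simp
    also have "\<dots> \<le> t k * (L2 * norm (w k - w (k - 1)) + \<sigma> k * (L1 * norm (w k - w (k - 1))))"
      using tk sk lipschitz_onD[OF F1_lip, of "w k" "w (k - 1)"]
        lipschitz_onD[OF F2_lip, of "w k" "w (k - 1)"]
      by (intro mult_left_mono add_mono) (auto simp: dist_norm)
    finally show ?thesis unfolding q_def by (simp add: algebra_simps)
  qed
  moreover have "d \<le> - h - s * (norm (w k - y))\<^sup>2"
  proof -
    have "\<mu> * (norm (w k - y))\<^sup>2 \<le> inner (F1 (w k) - F1 y) (w k - y)"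
      using F1_strong unfolding strongly_monotone_def by blast
    then have "t k * \<sigma> k * (\<mu> * (norm (w k - y))\<^sup>2)
        \<le> t k * \<sigma> k * inner (F1 (w k) - F1 y) (w k - y)"
      using tk sk by (intro mult_left_mono) auto
    then show ?thesis
      unfolding d_def h_def s_def b_def G_def rbifun_def
      by (simp add: inner_diff_left inner_diff_right inner_add_left algebra_simps)
  qed
  moreover have "0 \<le> s" unfolding s_def using tk sk \<mu>_pos by simp
  moreover have "8 * q\<^sup>2 + 2 * s \<le> 1"
    using stepsize[OF k] unfolding q_def s_def by (simp add: power_mult_distrib mult.assoc)
  ultimately have "(norm (z (k + 1) - y))\<^sup>2 + 1/2 * (norm (z (k + 1) - w k))\<^sup>2
      \<le> (1 - s) * ((norm (z k - y))\<^sup>2 + 1/2 * (norm (z k - w (k - 1)))\<^sup>2) - 2 * h"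
    by (rule optimistic_contraction)
  then show ?thesis unfolding energy_def s_def h_def by simp
qed

lemma contraction_factor:
  assumes "1 \<le> k"
  shows "1/2 \<le> 1 - t k * \<sigma> k * \<mu>" and "1 - t k * \<sigma> k * \<mu> \<le> 1"
proof -
  have "0 \<le> 8 * (t k)\<^sup>2 * (L2 + \<sigma> k * L1)\<^sup>2" by simp
  then show "1/2 \<le> 1 - t k * \<sigma> k * \<mu>" using stepsize[OF assms] by linarith
  show "1 - t k * \<sigma> k * \<mu> \<le> 1" using t_pos[OF assms] \<sigma>_pos[OF assms] \<mu>_pos by simp
qed

lemma gam_pos: "0 < gam \<mu> t \<sigma> k"
  unfolding gam_def
proof (rule prod_pos)
  show "0 < inverse (1 - t i * \<sigma> i * \<mu>)" if "i \<in> {1..k}" for i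
    using contraction_factor(1)[of i] that by simp
qed

lemma gam_contraction:
  assumes "1 \<le> k"
  shows "gam \<mu> t \<sigma> k * (1 - t k * \<sigma> k * \<mu>) = gam \<mu> t \<sigma> (k - 1)"
proof -
  obtain j where j: "k = Suc j" using assms by (cases k) auto
  show ?thesis using contraction_factor(1)[OF assms] unfolding gam_def j by simp
qed

lemma weighted_gap_sum:
  assumes mono: "monotone_operator F2" and y: "y \<in> edom g1 \<inter> edom g2"
    and c: "\<And>k. 1 \<le> k \<Longrightarrow> 0 \<le> c k"
    and cq: "\<And>k. 1 \<le> k \<Longrightarrow> c k * (1 - t k * \<sigma> k * \<mu>) \<le> c (k - 1)"
    and c0: "0 \<le> c 0"
  shows "(\<Sum>k=1..K. c k * t k * (rbifun F2 g2 (w k) y + \<sigma> k * rbifun F1 g1 (w k) y))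
    \<le> c 0 * (norm (z 1 - y))\<^sup>2 / 2"
proof -
  define h where "h k = 2 * t k * (rbifun F2 g2 (w k) y + \<sigma> k * rbifun F1 g1 (w k) y)" for k
  have rec: "energy y (k + 1) \<le> (1 - t k * \<sigma> k * \<mu>) * energy y k - h k" if k: "1 \<le> k" for k
  proof -
    have "h k \<le> 2 * t k * (\<sigma> k * rbifun F1 g1 (w k) y - rbifun F2 g2 y (w k))"
      unfolding h_def using rbifun_antisym_le[OF mono, of g2 "w k" y] t_pos[OF k]
      by (intro mult_left_mono) simp_all
    then show ?thesis using energy_step[OF k y] by linarith
  qed
  have "(\<Sum>k=1..K. c k * h k) + c K * energy y (K + 1) \<le> c 0 * energy y 1"
    using rec energy_nonneg c cq
    by (rule weighted_telescope[where e = "energy y" and h = h and q = "\<lambda>k. 1 - t k * \<sigma> k * \<mu>"])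
  moreover have "0 \<le> c K * energy y (K + 1)"
    by (rule mult_nonneg_nonneg[OF _ energy_nonneg]) (use c c0 in \<open>cases K; simp\<close>)
  moreover have "(\<Sum>k=1..K. c k * h k)
      = 2 * (\<Sum>k=1..K. c k * t k * (rbifun F2 g2 (w k) y + \<sigma> k * rbifun F1 g1 (w k) y))"
    unfolding sum_distrib_left by (intro sum.cong) (simp_all add: h_def)
  ultimately show ?thesis unfolding energy_initial by simp
qed

text \<open>With \<open>p\<close> the multiplier of a solution \<open>y\<close>, the sum of the penalty excesses is all that the
  energy around \<open>y\<close> can gain.\<close>

lemma half_iterates_bounded:
  assumes y: "y \<in> edom g1 \<inter> edom g2"
    and p: "\<And>x. x \<in> edom g1 \<Longrightarrow> - inner p (x - y) \<le> rbifun F1 g1 x y"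
    and M: "\<And>K. (\<Sum>k=1..K. t k * (rbifun F2 g2 y (w k) + \<sigma> k * inner p (w k - y))) \<le> M"
  obtains R where "\<And>k. 1 \<le> k \<Longrightarrow> norm (w k) \<le> R"
proof -
  define h where "h k = 2 * t k * (- (rbifun F2 g2 y (w k) + \<sigma> k * inner p (w k - y)))" for k
  have rec: "energy y (k + 1) \<le> (1 - t k * \<sigma> k * \<mu>) * energy y k - h k" if k: "1 \<le> k" for k
  proof -
    have "\<sigma> k * (- inner p (w k - y)) \<le> \<sigma> k * rbifun F1 g1 (w k) y"
      using p[of "w k"] iterates_in_domain(1)[OF k] \<sigma>_pos[OF k]
      by (intro mult_left_mono) simp_all
    then have "h k \<le> 2 * t k * (\<sigma> k * rbifun F1 g1 (w k) y - rbifun F2 g2 y (w k))"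
      unfolding h_def using t_pos[OF k] by (intro mult_left_mono) simp_all
    then show ?thesis using energy_step[OF k y] by linarith
  qed
  define B where "B = (norm (z 1 - y))\<^sup>2 + 2 * M"
  have E: "energy y (k + 1) \<le> B" for k
  proof -
    have "(\<Sum>k=1..k. 1 * h k) + 1 * energy y (k + 1) \<le> 1 * energy y 1"
      using rec energy_nonneg
      by (rule weighted_telescope[where e = "energy y" and h = h and q = "\<lambda>k. 1 - t k * \<sigma> k * \<mu>"])
        (use contraction_factor(2) in auto)
    moreover have "(\<Sum>k=1..k. 1 * h k)
        = - 2 * (\<Sum>k=1..k. t k * (rbifun F2 g2 y (w k) + \<sigma> k * inner p (w k - y)))"
      unfolding sum_distrib_left by (intro sum.cong) (simp_all add: h_def right_diff_distrib distrib_left)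
    ultimately show ?thesis using M[of k] unfolding B_def energy_initial by linarith
  qed
  have "norm (w k) \<le> norm y + sqrt B + sqrt (2 * B)" for k
  proof -
    have "(norm (z (k + 1) - y))\<^sup>2 \<le> B" "(norm (z (k + 1) - w k))\<^sup>2 \<le> 2 * B"
      using E[of k] zero_le_power2[of "norm (z (k + 1) - y)"]
        zero_le_power2[of "norm (z (k + 1) - w k)"]
      unfolding energy_def add_diff_cancel_right' by linarith+
    then have "norm (z (k + 1) - y) \<le> sqrt B" "norm (z (k + 1) - w k) \<le> sqrt (2 * B)"
      by (simp_all add: real_le_rsqrt)
    moreover have "norm (w k) \<le> norm y + norm (z (k + 1) - y) + norm (z (k + 1) - w k)"
      using norm_triangle_ineq4[of "z (k + 1)" "z (k + 1) - w k"]
        norm_triangle_ineq[of y "z (k + 1) - y"] by simp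
    ultimately show ?thesis by linarith
  qed
  then show thesis by (rule that)
qed

section \<open>Rates for the weighted averages\<close>

abbreviation \<gamma> :: "nat \<Rightarrow> real" where
  "\<gamma> \<equiv> gam \<mu> t \<sigma>"

abbreviation zbar :: "nat \<Rightarrow> 'a" where
  "zbar \<equiv> weighted_avg (\<lambda>i. t i * \<sigma> i * \<gamma> i) w"

lemma weight_pos: "1 \<le> i \<Longrightarrow> 0 < t i * \<sigma> i * \<gamma> i"
  using t_pos \<sigma>_pos gam_pos by simp

lemma weight_sum_pos: "1 \<le> K \<Longrightarrow> 0 < (\<Sum>i=1..K. t i * \<sigma> i * \<gamma> i)"
  by (intro sum_pos) (auto intro: weight_pos)

lemma average_in_edom:
  assumes "1 \<le> K"
  shows "zbar K \<in> edom g1" and "zbar K \<in> edom g2"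
proof -
  have w_dom: "w i \<in> edom g1" "w i \<in> edom g2" if "1 \<le> i" for i
    using iterates_in_domain(1)[OF that] by auto
  show "zbar K \<in> edom g1"
    by (rule weighted_avg_Jensen(1)[OF Gamma0_convex_on[OF g1] assms weight_pos w_dom(1)])
  show "zbar K \<in> edom g2"
    by (rule weighted_avg_Jensen(1)[OF Gamma0_convex_on[OF g2] assms weight_pos w_dom(2)])
qed

text \<open>At a solution \<open>y\<close> of the lower-level problem its bifunction is nonnegative, so the
  penalised estimate only retains the upper-level part; the weights \<open>\<gamma>\<close> use up the contraction.\<close>

lemma optimality_rate:
  assumes mono: "monotone_operator F2" and K: "1 \<le> K" and y: "y \<in> edom g1 \<inter> edom g2"
    and sol: "y \<in> zer (\<lambda>x. {F2 x} + subdiff g2 x)"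
  shows "rbifun F1 g1 (zbar K) y
    \<le> (norm (z 1 - y))\<^sup>2 / (2 * (\<Sum>i=1..K. t i * \<sigma> i * \<gamma> i))"
proof -
  have w_dom: "w i \<in> edom g1" "w i \<in> edom g2" if "1 \<le> i" for i
    using iterates_in_domain(1)[OF that] by auto
  have "rbifun F1 g1 (zbar K) y * (\<Sum>i=1..K. t i * \<sigma> i * \<gamma> i)
      \<le> (\<Sum>i=1..K. t i * \<sigma> i * \<gamma> i * rbifun F1 g1 (w i) y)"
    by (rule weighted_avg_Jensen(2)[OF rbifun_convex[OF g1] K weight_pos w_dom(1)])
  also have "\<dots> \<le> (\<Sum>i=1..K. \<gamma> i * t i * (rbifun F2 g2 (w i) y + \<sigma> i * rbifun F1 g1 (w i) y))"
  proof (rule sum_mono)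
    fix i assume i: "i \<in> {1..K}"
    then have "0 \<le> \<gamma> i * t i * rbifun F2 g2 (w i) y"
      using zer_rbifun_nonneg[OF g2 sol w_dom(2)] t_pos[of i] gam_pos[of i] by simp
    then show "t i * \<sigma> i * \<gamma> i * rbifun F1 g1 (w i) y
        \<le> \<gamma> i * t i * (rbifun F2 g2 (w i) y + \<sigma> i * rbifun F1 g1 (w i) y)"
      by (simp add: algebra_simps)
  qed
  also have "\<dots> \<le> \<gamma> 0 * (norm (z 1 - y))\<^sup>2 / 2"
    using gam_pos gam_contraction by (intro weighted_gap_sum[OF mono y]) (auto simp: less_imp_le)
  finally show ?thesis
    using weight_sum_pos[OF K] by (simp add: gam_def field_simps)
qed

text \<open>Multiplying the weights by the decreasing parameter \<open>\<sigma>\<close> keeps them admissible for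
  telescoping and turns the same estimate into one for the lower-level bifunction.\<close>

lemma feasibility_rate:
  assumes mono: "monotone_operator F2" and K: "1 \<le> K" and y: "y \<in> edom g1 \<inter> edom g2"
    and dec: "\<And>k. 1 \<le> k \<Longrightarrow> \<sigma> (k + 1) \<le> \<sigma> k"
    and C: "\<And>k. 1 \<le> k \<Longrightarrow> - C \<le> rbifun F1 g1 (w k) y"
  shows "rbifun F2 g2 (zbar K) y
    \<le> \<sigma> 1 * (norm (z 1 - y))\<^sup>2 / (2 * (\<Sum>i=1..K. t i * \<sigma> i * \<gamma> i))
      + C * ((\<Sum>i=1..K. t i * (\<sigma> i)\<^sup>2 * \<gamma> i) / (\<Sum>i=1..K. t i * \<sigma> i * \<gamma> i))"
proof -
  let ?T = "\<Sum>i=1..K. t i * \<sigma> i * \<gamma> i" and ?S = "\<Sum>i=1..K. t i * (\<sigma> i)\<^sup>2 * \<gamma> i"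
  \<comment> \<open>The weight \<open>\<sigma> 0\<close> is unrestricted, so \<open>\<sigma> 1\<close> takes its place.\<close>
  define c where "c k = (if k = 0 then \<sigma> 1 else \<sigma> k * \<gamma> k)" for k
  have cq: "c k * (1 - t k * \<sigma> k * \<mu>) \<le> c (k - 1)" if k: "1 \<le> k" for k
  proof -
    have "c k * (1 - t k * \<sigma> k * \<mu>) = \<sigma> k * \<gamma> (k - 1)"
      using k gam_contraction[OF k] by (simp add: c_def mult.assoc)
    also have "\<dots> \<le> c (k - 1)"
    proof (cases "k = 1")
      case True
      then show ?thesis by (simp add: c_def gam_def)
    next
      case False
      then have "\<sigma> k \<le> \<sigma> (k - 1)" using dec[of "k - 1"] k by simp
      then show ?thesis
        using False k gam_pos[of "k - 1"] by (simp add: c_def)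
    qed
    finally show ?thesis .
  qed
  have w_dom: "w i \<in> edom g2" if "1 \<le> i" for i
    using iterates_in_domain(1)[OF that] by auto
  have "rbifun F2 g2 (zbar K) y * ?T \<le> (\<Sum>i=1..K. t i * \<sigma> i * \<gamma> i * rbifun F2 g2 (w i) y)"
    by (rule weighted_avg_Jensen(2)[OF rbifun_convex[OF g2] K weight_pos w_dom])
  also have "\<dots> \<le> (\<Sum>i=1..K. c i * t i * (rbifun F2 g2 (w i) y + \<sigma> i * rbifun F1 g1 (w i) y)
      + C * (t i * (\<sigma> i)\<^sup>2 * \<gamma> i))"
  proof (rule sum_mono)
    fix i assume "i \<in> {1..K}"
    then have i: "1 \<le> i" by simp
    have "t i * (\<sigma> i)\<^sup>2 * \<gamma> i * (- C) \<le> t i * (\<sigma> i)\<^sup>2 * \<gamma> i * rbifun F1 g1 (w i) y"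
      using C[OF i] t_pos[OF i] gam_pos[of i] by (intro mult_left_mono) (auto simp: less_imp_le)
    then show "t i * \<sigma> i * \<gamma> i * rbifun F2 g2 (w i) y
        \<le> c i * t i * (rbifun F2 g2 (w i) y + \<sigma> i * rbifun F1 g1 (w i) y)
          + C * (t i * (\<sigma> i)\<^sup>2 * \<gamma> i)"
      using i by (simp add: c_def power2_eq_square algebra_simps)
  qed
  also have "\<dots> \<le> c 0 * (norm (z 1 - y))\<^sup>2 / 2 + C * ?S"
    unfolding sum.distrib sum_distrib_left[symmetric]
    using \<sigma>_pos gam_pos
    by (intro add_right_mono weighted_gap_sum[OF mono y _ cq]) (auto simp: c_def less_imp_le)
  finally show ?thesis
    using weight_sum_pos[OF K] by (simp add: c_def field_simps)
qed

text \<open>In the first case the excess series bounds the energy around a solution of the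
  hierarchical problem; in the second case the half steps stay in a bounded domain.\<close>

lemma half_iterates_bounded_if_excess_summable_or_compact:
  assumes S: "S \<noteq> {}" "S \<subseteq> edom g2" and x: "x \<in> zer (\<lambda>x. {F1 x} + subdiff g1 x + normal_cone S x)"
    and alt: "(\<forall>p\<in>op_range (normal_cone S). (\<Sum>n. let k = Suc n in
        ereal (t k) * ((SUP x\<in>S. phi F2 g2 x (\<sigma> k *\<^sub>R p)) - support_fun S (\<sigma> k *\<^sub>R p))) < \<infinity>)
      \<or> compact (edom g1 \<inter> edom g2)"
  obtains R where "\<And>k. 1 \<le> k \<Longrightarrow> norm (w k) \<le> R"
  using alt
proof
  assume "compact (edom g1 \<inter> edom g2)"
  then obtain R where "\<And>x. x \<in> edom g1 \<inter> edom g2 \<Longrightarrow> norm x \<le> R"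
    by (meson compact_imp_bounded bounded_iff)
  then show thesis using that iterates_in_domain(1) by blast
next
  assume sums: "\<forall>p\<in>op_range (normal_cone S). (\<Sum>n. let k = Suc n in
    ereal (t k) * ((SUP x\<in>S. phi F2 g2 x (\<sigma> k *\<^sub>R p)) - support_fun S (\<sigma> k *\<^sub>R p))) < \<infinity>"
  obtain p where p: "p \<in> normal_cone S x" and x1: "x \<in> edom g1" and xS: "x \<in> S"
    and mult: "\<And>y. y \<in> edom g1 \<Longrightarrow> - inner p (y - x) \<le> rbifun F1 g1 y x"
    using zer_normal_cone_multiplier[OF g1 x] by blast
  have x2: "x \<in> edom g2" using xS S by auto
  define A where "A k = (SUP x\<in>S. phi F2 g2 x (\<sigma> k *\<^sub>R p)) - support_fun S (\<sigma> k *\<^sub>R p)" for k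
  have A_ge: "ereal (rbifun F2 g2 x y + \<sigma> k * inner p (y - x)) \<le> A k"
    if "1 \<le> k" "y \<in> edom g2" for k y
    unfolding A_def using penalty_excess_lower[OF g2 p _ x2 that(2)] \<sigma>_pos[OF that(1)]
    by (simp add: less_imp_le)
  have A_nonneg: "0 \<le> ereal (t (Suc n)) * A (Suc n)" for n
  proof -
    have "ereal 0 \<le> A (Suc n)" using A_ge[of "Suc n", OF _ x2] by (simp add: rbifun_def)
    then show ?thesis
      using t_pos[of "Suc n"] unfolding zero_ereal_def[symmetric]
      by (intro ereal_0_le_mult) auto
  qed
  define M where "M = (\<Sum>n. ereal (t (Suc n)) * A (Suc n))"
  have "p \<in> op_range (normal_cone S)" using p unfolding op_range_def by blast
  then have "M < \<infinity>" using sums unfolding M_def A_def Let_def by blast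
  moreover have "0 \<le> M" unfolding M_def using A_nonneg by (rule suminf_0_le)
  ultimately obtain m where m: "M = ereal m" by (cases M) auto
  have "(\<Sum>k=1..K. t k * (rbifun F2 g2 x (w k) + \<sigma> k * inner p (w k - x))) \<le> m" for K
  proof -
    have "ereal (\<Sum>k=1..K. t k * (rbifun F2 g2 x (w k) + \<sigma> k * inner p (w k - x)))
        = (\<Sum>k=1..K. ereal (t k) * ereal (rbifun F2 g2 x (w k) + \<sigma> k * inner p (w k - x)))"
      by simp
    also have "\<dots> \<le> (\<Sum>k=1..K. ereal (t k) * A k)"
      using A_ge iterates_in_domain(1) t_pos
      by (intro sum_mono ereal_mult_left_mono) (auto simp: less_imp_le)
    also have "\<dots> = (\<Sum>n<K. ereal (t (Suc n)) * A (Suc n))"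
      using sum.atLeast1_atMost_eq[of "\<lambda>k. ereal (t k) * A k" K] by simp
    also have "\<dots> \<le> M" unfolding M_def using A_nonneg by (rule suminf_upper)
    finally show ?thesis unfolding m by simp
  qed
  then show thesis
    using half_iterates_bounded[of x p m] x1 x2 mult that by blast
qed

end

section \<open>Distances and suprema\<close>

lemma infdist_le_of_powr_le:
  assumes \<alpha>: "0 < \<alpha>" and \<rho>: "1 \<le> (\<rho>::real)" and le: "\<alpha> / \<rho> * infdist v S powr \<rho> \<le> Q"
  shows "infdist v S \<le> (Q / (\<alpha> / \<rho>)) powr (1 / \<rho>)"
proof -
  have "infdist v S = (infdist v S powr \<rho>) powr (1 / \<rho>)"
    using \<rho> by (simp add: powr_powr infdist_nonneg)
  also have "\<dots> \<le> (Q / (\<alpha> / \<rho>)) powr (1 / \<rho>)"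
    using \<alpha> \<rho> le by (intro powr_mono2) (auto simp: field_simps)
  finally show ?thesis .
qed

lemma norm_power2_le_SUP:
  fixes U :: "'a::real_inner set"
  assumes U: "compact U" and V: "V \<subseteq> U" and x: "x \<in> V"
  shows "(norm (a - x))\<^sup>2 \<le> (SUP x\<in>V. (norm (a - x))\<^sup>2)"
proof -
  have "bounded ((\<lambda>x. (norm (a - x))\<^sup>2) ` U)"
    using U by (intro compact_imp_bounded compact_continuous_image continuous_intros)
  then have "bdd_above ((\<lambda>x. (norm (a - x))\<^sup>2) ` V)"
    by (rule bdd_above_mono[OF bounded_imp_bdd_above image_mono[OF V]])
  then show ?thesis by (rule cSUP_upper[OF x])
qed

section \<open>The convergence rates\<close>

theorem theorem5p1:
  fixes F1 F2 :: "'a::{real_inner, polish_space} \<Rightarrow> 'a"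
    and g1 g2 :: "'a \<Rightarrow> ereal"
    and L1 L2 \<mu> :: real
    and t \<sigma> \<gamma> :: "nat \<Rightarrow> real"
    and z w zbar :: "nat \<Rightarrow> 'a"
    and S1 S2 U2 :: "'a set"
  assumes "monotone_operator F1" and "monotone_operator F2"
    and "L1-lipschitz_on UNIV F1" and "L2-lipschitz_on UNIV F2"
    and "g1 \<in> Gamma0" and "g2 \<in> Gamma0"
    and "edom g1 \<inter> edom g2 \<noteq> {}"
    and "\<mu> > 0" and "strongly_monotone \<mu> F1"
    and S2: "S2 = zer (\<lambda>x. {F2 x} + subdiff g2 x)" and "S2 \<noteq> {}"
    and S1: "S1 = hier_solutions F1 g1 S2"
    and "S1 = zer (\<lambda>x. {F1 x} + subdiff g1 x + normal_cone S2 x)" and "S1 \<noteq> {}"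
    and "closed (edom g1 \<inter> edom g2)"
    and "\<And>A B. \<lbrakk>compact A; compact B; A \<subseteq> edom g1 \<inter> edom g2; B \<subseteq> edom g1 \<inter> edom g2\<rbrakk>
           \<Longrightarrow> (SUP (x, y)\<in>A \<times> B. \<bar>g1 x - g1 y\<bar>) < \<infinity>"
    and "\<And>k. k \<ge> 1 \<Longrightarrow> t k > 0" and "\<And>k. k \<ge> 1 \<Longrightarrow> \<sigma> k > 0"
    and "\<And>k. k \<ge> 1 \<Longrightarrow> \<sigma> (k + 1) \<le> \<sigma> k"
    and "\<sigma> \<longlonglongrightarrow> 0"
    and "filterlim (\<lambda>K. \<Sum>k=1..K. t k) at_top sequentially"
    and "filterlim (\<lambda>K. \<sigma> K * (\<Sum>k=1..K. t k)) at_top sequentially"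
    and "(\<lambda>K. (\<Sum>k=1..K. t k * \<sigma> k) / (\<Sum>k=1..K. t k)) \<longlonglongrightarrow> 0"
    and "(\<forall>p\<in>op_range (normal_cone S2).
            (\<Sum>n. let k = Suc n in
               ereal (t k) * ((SUP x\<in>S2. phi F2 g2 x (\<sigma> k *\<^sub>R p)) - support_fun S2 (\<sigma> k *\<^sub>R p))) < \<infinity>)
         \<or> compact (edom g1 \<inter> edom g2)"
    and "optimistic_extragradient F1 g1 F2 g2 t \<sigma> z w"
    and "\<And>k. k \<ge> 1 \<Longrightarrow> 8 * (t k)\<^sup>2 * (L2 + \<sigma> k * L1)\<^sup>2 + 2 * t k * \<sigma> k * \<mu> \<le> 1"
    and \<gamma>: "\<gamma> = gam \<mu> t \<sigma>"
    and zbar: "zbar = weighted_avg (\<lambda>i. t i * \<sigma> i * \<gamma> i) w"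
    and "U2 \<noteq> {}" and "compact U2" and "U2 \<subseteq> edom g1 \<inter> edom g2"
  shows "\<exists>C>0.
     (\<forall>K\<ge>1. gap F2 g2 (zbar K) U2 \<le>
        ereal (\<sigma> 1 * (SUP x\<in>U2. (norm (z 1 - x))\<^sup>2) / (2 * (\<Sum>i=1..K. t i * \<sigma> i * \<gamma> i))
             + C * ((\<Sum>i=1..K. t i * (\<sigma> i)\<^sup>2 * \<gamma> i) / (\<Sum>i=1..K. t i * \<sigma> i * \<gamma> i)))) \<and>
     (\<forall>U1. U1 \<noteq> {} \<and> compact U1 \<and> U1 \<subseteq> edom g1 \<inter> edom g2 \<and> U1 \<inter> S1 \<noteq> {} \<longrightarrow>
        (\<exists>B>0.
           (\<forall>K\<ge>1.
              ereal (- B * infdist (zbar K) S2) \<le> gap F1 g1 (zbar K) (U1 \<inter> S2) \<and>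
              gap F1 g1 (zbar K) (U1 \<inter> S2) \<le>
                ereal ((SUP x\<in>U1 \<inter> S2. (norm (z 1 - x))\<^sup>2) / (2 * (\<Sum>i=1..K. t i * \<sigma> i * \<gamma> i)))) \<and>
           (\<forall>\<alpha> \<rho>. \<alpha> > 0 \<and> \<rho> \<ge> 1 \<and> weakly_sharp F2 g2 S2 \<alpha> \<rho> \<and> U2 \<inter> S2 \<noteq> {} \<longrightarrow>
              (\<forall>K\<ge>1.
                 ereal (- B *
                   ((\<sigma> 1 * (SUP x\<in>U2. (norm (z 1 - x))\<^sup>2)
                        / (2 * (\<alpha> / \<rho>) * (\<Sum>i=1..K. t i * \<sigma> i * \<gamma> i))
                     + C * (\<Sum>i=1..K. t i * (\<sigma> i)\<^sup>2 * \<gamma> i)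
                        / ((\<alpha> / \<rho>) * (\<Sum>i=1..K. t i * \<sigma> i * \<gamma> i))) powr (1 / \<rho>)))
                 \<le> gap F1 g1 (zbar K) (U1 \<inter> S2)))))"
proof -
  interpret optimistic_run F1 F2 g1 g2 L1 L2 \<mu> t \<sigma> z w
    using assms by unfold_locales auto
  let ?T = "\<lambda>K. \<Sum>i=1..K. t i * \<sigma> i * \<gamma> i"
  let ?S = "\<lambda>K. \<Sum>i=1..K. t i * (\<sigma> i)\<^sup>2 * \<gamma> i"
  note mono = assms(2) and dec = assms(19)
  have T: "0 < ?T K" if "1 \<le> K" for K
    using weight_sum_pos[OF that] unfolding \<gamma> .
  have zbar_dom: "zbar K \<in> edom g1" "zbar K \<in> edom g2" if "1 \<le> K" for K
    using average_in_edom[OF that] unfolding zbar \<gamma> by auto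
  have S2_dom: "S2 \<subseteq> edom g2"
    unfolding S2 zer_add_subdiff[abs_def] using subdiff_edom[OF g2] zer_add_subdiff by blast
  obtain x1 where "x1 \<in> S1" using assms(14) by blast
  then have "x1 \<in> zer (\<lambda>x. {F1 x} + subdiff g1 x + normal_cone S2 x)" using assms(13) by simp
  then obtain R where R: "\<And>k. 1 \<le> k \<Longrightarrow> norm (w k) \<le> R"
    using half_iterates_bounded_if_excess_summable_or_compact[OF assms(11) S2_dom _ assms(24)]
    by blast
  have "continuous_on U2 F1"
    using lipschitz_on_continuous_on[OF F1_lip] continuous_on_subset by blast
  then obtain C where C: "0 < C"
    and C_le: "\<And>x y. x \<in> edom g1 \<Longrightarrow> norm x \<le> R \<Longrightarrow> y \<in> U2 \<Longrightarrow> - C \<le> rbifun F1 g1 x y"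
    using rbifun_lower_bound[OF g1, of U2 F1 R] assms(16)[of U2 U2] assms(29-31) by blast
  define Q where "Q K = \<sigma> 1 * (SUP x\<in>U2. (norm (z 1 - x))\<^sup>2) / (2 * ?T K)
    + C * (?S K / ?T K)" for K
  have feas: "rbifun F2 g2 (zbar K) y \<le> Q K" if K: "1 \<le> K" and y: "y \<in> U2" for K y
  proof -
    have "rbifun F2 g2 (zbar K) y \<le> \<sigma> 1 * (norm (z 1 - y))\<^sup>2 / (2 * ?T K) + C * (?S K / ?T K)"
      unfolding zbar \<gamma> using y assms(31) iterates_in_domain(1) R C_le
      by (intro feasibility_rate[OF mono K _ dec]) auto
    also have "\<dots> \<le> Q K"
      unfolding Q_def using norm_power2_le_SUP[OF assms(30) subset_refl y] \<sigma>_pos[of 1] T[OF K]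
      by (intro add_right_mono divide_right_mono mult_left_mono) auto
    finally show ?thesis .
  qed
  have claim_feas: "gap F2 g2 (zbar K) U2 \<le> ereal (Q K)" if K: "1 \<le> K" for K
    unfolding gap_def using feas[OF K] bifun_eq_rbifun[OF g2 zbar_dom(2)[OF K]] assms(31)
    by (intro SUP_least) auto
  have claim_opt: "gap F1 g1 (zbar K) (U1 \<inter> S2)
      \<le> ereal ((SUP x\<in>U1 \<inter> S2. (norm (z 1 - x))\<^sup>2) / (2 * ?T K))"
    if U1: "compact U1" "U1 \<subseteq> edom g1 \<inter> edom g2" and K: "1 \<le> K" for U1 K
    unfolding gap_def
  proof (rule SUP_least)
    fix y assume y: "y \<in> U1 \<inter> S2"
    have "rbifun F1 g1 (zbar K) y \<le> (norm (z 1 - y))\<^sup>2 / (2 * ?T K)"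
      unfolding zbar \<gamma> using y U1 S2 by (intro optimality_rate[OF mono K]) auto
    also have "\<dots> \<le> (SUP x\<in>U1 \<inter> S2. (norm (z 1 - x))\<^sup>2) / (2 * ?T K)"
      using norm_power2_le_SUP[OF U1(1) _ y] T[OF K] by (intro divide_right_mono) auto
    finally show "bifun F1 g1 (zbar K) y
        \<le> ereal ((SUP x\<in>U1 \<inter> S2. (norm (z 1 - x))\<^sup>2) / (2 * ?T K))"
      using bifun_eq_rbifun[OF g1 zbar_dom(1)[OF K]] y U1 by auto
  qed
  have claim_lower: "\<exists>B>0. \<forall>K\<ge>1. ereal (- B * infdist (zbar K) S2) \<le> gap F1 g1 (zbar K) (U1 \<inter> S2)"
    if ne: "U1 \<inter> S1 \<noteq> {}" for U1
  proof -
    obtain x where x: "x \<in> U1" "x \<in> S1" using ne by blast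
    then have "x \<in> zer (\<lambda>x. {F1 x} + subdiff g1 x + normal_cone S2 x)" using assms(13) by simp
    then obtain p where p: "p \<in> normal_cone S2 x" "x \<in> edom g1" "x \<in> S2"
      and mult: "\<And>y. y \<in> edom g1 \<Longrightarrow> - inner p (y - x) \<le> rbifun F1 g1 y x"
      using zer_normal_cone_multiplier[OF g1] by blast
    \<comment> \<open>The summand \<open>1\<close> keeps the constant positive when \<open>p = 0\<close>.\<close>
    have "ereal (- (norm p + 1) * infdist (zbar K) S2) \<le> gap F1 g1 (zbar K) (U1 \<inter> S2)"
      if K: "1 \<le> K" for K
    proof -
      have "- (norm p + 1) * infdist (zbar K) S2 \<le> rbifun F1 g1 (zbar K) x"
        using normal_cone_infdist[OF p(1), of "zbar K"] mult[OF zbar_dom(1)[OF K]]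
          infdist_nonneg[of "zbar K" S2]
        by (simp add: algebra_simps)
      then have "ereal (- (norm p + 1) * infdist (zbar K) S2) \<le> bifun F1 g1 (zbar K) x"
        unfolding bifun_eq_rbifun[OF g1 zbar_dom(1)[OF K] p(2)] by simp
      also have "\<dots> \<le> gap F1 g1 (zbar K) (U1 \<inter> S2)"
        unfolding gap_def using x p by (intro SUP_upper) auto
      finally show ?thesis .
    qed
    then show ?thesis by (intro exI[of _ "norm p + 1"]) (auto intro: add_nonneg_pos)
  qed
  have claim_sharp: "infdist (zbar K) S2
      \<le> (\<sigma> 1 * (SUP x\<in>U2. (norm (z 1 - x))\<^sup>2) / (2 * (\<alpha> / \<rho>) * ?T K)
          + C * ?S K / ((\<alpha> / \<rho>) * ?T K)) powr (1 / \<rho>)"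
    if \<alpha>\<rho>: "0 < \<alpha>" "1 \<le> \<rho>" and sharp: "weakly_sharp F2 g2 S2 \<alpha> \<rho>"
      and ne: "U2 \<inter> S2 \<noteq> {}" and K: "1 \<le> K" for \<alpha> \<rho> :: real and K
  proof -
    obtain x where x: "x \<in> U2" "x \<in> S2" using ne by blast
    have "ereal (\<alpha> / \<rho> * infdist (zbar K) S2 powr \<rho>) \<le> bifun F2 g2 (zbar K) x"
      using sharp x zbar_dom(2)[OF K] unfolding weakly_sharp_def by blast
    then have "\<alpha> / \<rho> * infdist (zbar K) S2 powr \<rho> \<le> Q K"
      using bifun_eq_rbifun[OF g2 zbar_dom(2)[OF K]] x S2_dom feas[OF K x(1)] by auto
    from infdist_le_of_powr_le[OF \<alpha>\<rho> this]
    have le: "infdist (zbar K) S2 \<le> (Q K / (\<alpha> / \<rho>)) powr (1 / \<rho>)" .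
    have div: "Q K / a = \<sigma> 1 * (SUP x\<in>U2. (norm (z 1 - x))\<^sup>2) / (2 * a * ?T K)
        + C * ?S K / (a * ?T K)" for a
      unfolding Q_def add_divide_distrib by (simp add: mult.commute mult.left_commute)
    show ?thesis using le unfolding div .
  qed
  show ?thesis
  proof (rule exI[of _ C], intro conjI allI impI C)
    fix K :: nat assume "1 \<le> K"
    from claim_feas[OF this] show "gap F2 g2 (zbar K) U2 \<le>
        ereal (\<sigma> 1 * (SUP x\<in>U2. (norm (z 1 - x))\<^sup>2) / (2 * ?T K) + C * (?S K / ?T K))"
      unfolding Q_def .
  next
    fix U1
    assume U1: "U1 \<noteq> {} \<and> compact U1 \<and> U1 \<subseteq> edom g1 \<inter> edom g2 \<and> U1 \<inter> S1 \<noteq> {}"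
    then obtain B where B: "B > 0"
      and lower: "\<And>K. K \<ge> 1 \<Longrightarrow> ereal (- B * infdist (zbar K) S2) \<le> gap F1 g1 (zbar K) (U1 \<inter> S2)"
      using claim_lower by blast
    have sharp_lower: "ereal (- B * r) \<le> gap F1 g1 (zbar K) (U1 \<inter> S2)"
      if "1 \<le> K" "infdist (zbar K) S2 \<le> r" for K r
      using B that by (intro order_trans[OF _ lower]) auto
    show "\<exists>B>0.
           (\<forall>K\<ge>1.
              ereal (- B * infdist (zbar K) S2) \<le> gap F1 g1 (zbar K) (U1 \<inter> S2) \<and>
              gap F1 g1 (zbar K) (U1 \<inter> S2) \<le>
                ereal ((SUP x\<in>U1 \<inter> S2. (norm (z 1 - x))\<^sup>2) / (2 * ?T K))) \<and>
           (\<forall>\<alpha> \<rho>. \<alpha> > 0 \<and> \<rho> \<ge> 1 \<and> weakly_sharp F2 g2 S2 \<alpha> \<rho> \<and> U2 \<inter> S2 \<noteq> {} \<longrightarrow>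
              (\<forall>K\<ge>1.
                 ereal (- B *
                   ((\<sigma> 1 * (SUP x\<in>U2. (norm (z 1 - x))\<^sup>2) / (2 * (\<alpha> / \<rho>) * ?T K)
                     + C * ?S K / ((\<alpha> / \<rho>) * ?T K)) powr (1 / \<rho>)))
                 \<le> gap F1 g1 (zbar K) (U1 \<inter> S2)))"
      using U1 B lower claim_opt sharp_lower claim_sharp
      by (intro exI[of _ B] conjI allI impI) auto
  qed
qed

end
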